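(* Let $f \in \mathbb{R}[z]$ be a non-constant polynomial. Then $f$ is eventually non-negative if and only if $f(z) = z^{k} g(z^{\ell})$ for some $k, \ell \in \mathbb{N}$ and some $g \in \mathbb{R}[z]$ that is strongly positive and satisfies the positive covering property.
   Context: $\mathbb{N} = \{0,1,2,\ldots\}$, and $z^0 = 1$. A polynomial $f \in \mathbb{R}[z]$ is \emph{eventually non-negative} if there is an $m_0$ such that for all integers $m \geq m_0$ all coefficients of $f^m$ are non-negative. A non-zero polynomial $g \in \mathbb{R}[z]$ is \emph{strongly positive} if $g(|z|) > |g(z)|$ for all $z \in \mathbb{C} \setminus \mathbb{R}_{\geq 0}$. Positive covering property: let $g(z) = a_0 + a_1 z + \cdots + a_d z^d$ be a degree $d$ polynomial with real coefficients and $a_0, a_d > 0$ (these sign conditions are part of the definition). Let $S^+(g) := \{ i : a_i > 0\}$ and $S^-(g) := \{ i : a_i < 0\}$. The polynomial $g$ has the \emph{one-sided positive covering property} if every element of $S^-(g)$ can be written as a sum of elements of $S^+(g)$, that is, $S^-(g) \subseteq S^+(g) + \cdots + S^+(g)$, where the right-hand side is the $d$-times iterated sumset of $S^+(g)$ (note $0 \in S^+(g)$). The polynomial $g$ has the \emph{positive covering property} if both $g(z)$ and its reverse $z^d g(1/z)$ have the one-sided positive covering property. *)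

theory Defs
  imports
    "HOL-Analysis.Analysis"
    "HOL-Library.Set_Algebras"
    "HOL-Computational_Algebra.Polynomial"
begin

definition eventually_nonneg :: "real poly \<Rightarrow> bool" where
  "eventually_nonneg f \<longleftrightarrow> (\<exists>m0. \<forall>m\<ge>m0. \<forall>i. coeff (f ^ m) i \<ge> 0)"

definition strongly_positive :: "real poly \<Rightarrow> bool" where
  "strongly_positive g \<longleftrightarrow>
     g \<noteq> 0 \<and>
     (\<forall>z::complex. z \<notin> \<real>\<^sub>\<ge>\<^sub>0 \<longrightarrow> poly g (norm z) > norm (poly (map_poly of_real g) z))"

definition pos_support :: "real poly \<Rightarrow> nat set" where
  "pos_support g = {i. coeff g i > 0}"

definition neg_support :: "real poly \<Rightarrow> nat set" where
  "neg_support g = {i. coeff g i < 0}"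

(* The sum is taken in the additive monoid of sets of naturals: it is the
   (degree g)-fold Minkowski sum of pos_support g with itself. *)
definition one_sided_pos_covering :: "real poly \<Rightarrow> bool" where
  "one_sided_pos_covering g \<longleftrightarrow>
     coeff g 0 > 0 \<and> lead_coeff g > 0 \<and>
     neg_support g \<subseteq> (\<Sum>_<degree g. pos_support g)"

(* Since coeff g 0 > 0, reflect_poly g is z^d g(1/z) with d = degree g. *)
definition pos_covering :: "real poly \<Rightarrow> bool" where
  "pos_covering g \<longleftrightarrow> one_sided_pos_covering g \<and> one_sided_pos_covering (reflect_poly g)"

end

theory Submission
  imports Defs "HOL-Complex_Analysis.Conformal_Mappings"
begin

text \<open>If \<open>g\<close> is strongly positive with the positive covering property, the coefficient of \<open>z ^ n\<close> in \<open>g ^ m\<close>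
  is treated in three ranges. For \<open>n \<le> \<epsilon> * m\<close>, the recurrence coming from the logarithmic derivative of
  \<open>g ^ m\<close> shows that the coefficients are non-negative and grow by a large factor along each shift by an index
  in the positive support, so that the covering property makes every negative term negligible. The range
  \<open>n \<ge> (d - \<epsilon>) * m\<close> follows by reversing \<open>g\<close>. In between, the saddle point method applies on circles
  whose radius \<open>r\<close> stays in a compact subset of the positive reals: strong positivity confines the integrand
  to a neighbourhood of the positive axis, and it forces the variance at the saddle point to be positive.

  Conversely, strip from \<open>f\<close> the power of \<open>z\<close> and the gcd of the exponents. The equality case of the triangle
  inequality for two consecutive powers of \<open>g\<close> yields strong positivity, and a minimal index violating
  the covering property would have a negative coefficient in every power. The choice \<open>l = 0\<close> is
  what accommodates monomials \<open>f\<close>, with \<open>g\<close> proportional to \<open>1 + z\<close>.\<close>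

subsection \<open>Coefficients of small index\<close>

text \<open>Compares coefficients in p * E(p^m) = m * E(p) * p^m, where \<open>E\<close> is the
  Euler operator z d/dz; the term k = 0 of the left product is isolated.\<close>

lemma coeff_power_recurrence:
  fixes p :: "real poly"
  shows "real n * coeff p 0 * coeff (p ^ m) n =
    (\<Sum>k=1..n. coeff p k * ((real m + 1) * real k - real n) * coeff (p ^ m) (n - k))"
proof -
  define E where "E q = pCons 0 (pderiv q)" for q :: "real poly"
  have cE: "coeff (E q) i = real i * coeff q i" for q i
    by (cases i) (auto simp: E_def coeff_pderiv)
  have "p * pderiv (p ^ m) = smult (real m) (pderiv p * p ^ m)"
    by (cases m) (simp_all del: power_Suc add: pderiv_power_Suc, simp add: mult_ac)
  hence eq: "p * E (p ^ m) = smult (real m) (E p * p ^ m)"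
    by (simp add: E_def)
  have split: "(\<Sum>k\<le>n. h k) = h 0 + (\<Sum>k=1..n. h k)" for h :: "nat \<Rightarrow> real"
  proof -
    have "{..n} = insert 0 {1..n}" by auto
    thus ?thesis by simp
  qed
  have "(\<Sum>k\<le>n. coeff p k * (real (n - k) * coeff (p ^ m) (n - k))) =
        real m * (\<Sum>k\<le>n. real k * coeff p k * coeff (p ^ m) (n - k))"
    using arg_cong[OF eq, of "\<lambda>q. coeff q n"] by (simp add: coeff_mult cE)
  hence "real n * coeff p 0 * coeff (p ^ m) n =
     (\<Sum>k=1..n. real m * (real k * coeff p k * coeff (p ^ m) (n - k))
        - coeff p k * (real (n - k) * coeff (p ^ m) (n - k)))"
    by (simp add: split sum_distrib_left sum_subtractf sum.distrib algebra_simps)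
  also have "\<dots> = (\<Sum>k=1..n. coeff p k * ((real m + 1) * real k - real n) * coeff (p ^ m) (n - k))"
    by (intro sum.cong) (auto simp: of_nat_diff algebra_simps)
  finally show ?thesis .
qed

text \<open>After zeros are dropped, at least two summands remain, since a single one would be
  \<open>q\<close> itself, whose coefficient is negative. Two are singled out: \<open>k\<close>
  points to the positive term used for comparison, and \<open>l\<close> provides a small
  factor.\<close>

lemma pos_covering_decomposition:
  assumes "one_sided_pos_covering g" "q \<in> neg_support g"
  obtains k l xs where "coeff g k > 0" "k > 0" "coeff g l > 0" "l > 0"
    "\<And>x. x \<in> set xs \<Longrightarrow> coeff g x > 0 \<and> x > 0" "q = k + (l + sum_list xs)"
proof -
  have g: "coeff g 0 > 0" "neg_support g \<subseteq> (\<Sum>_<degree g. pos_support g)"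
    using assms by (auto simp: one_sided_pos_covering_def)
  obtain s where s: "q = sum s {..<degree g}" "\<And>i. i < degree g \<Longrightarrow> s i \<in> pos_support g"
    using g(2) assms(2) by (auto simp: set_sum_alt)
  define ys where "ys = filter (\<lambda>x. x \<noteq> 0) (map s [0..<degree g])"
  have "sum_list (filter (\<lambda>x. x \<noteq> 0) zs) = sum_list zs" for zs :: "nat list"
    by (induction zs) auto
  hence sum: "sum_list ys = q"
    by (simp add: ys_def s(1) interv_sum_list_conv_sum_set_nat atLeast0LessThan)
  have pos: "coeff g x > 0 \<and> x > 0" if "x \<in> set ys" for x
    using that s(2) by (auto simp: ys_def pos_support_def)
  have q: "coeff g q < 0" using assms(2) by (simp add: neg_support_def)
  with g(1) have "q \<noteq> 0" by (intro notI) auto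
  with sum obtain k zs where ys: "ys = k # zs" by (cases ys) auto
  have "zs \<noteq> []"
  proof
    assume "zs = []"
    hence "q = k" using sum ys by simp
    thus False using pos[of k] ys q by simp
  qed
  then obtain l xs where "zs = l # xs" by (cases zs) auto
  thus thesis using that[of k l xs] pos sum ys by auto
qed

text \<open>The logarithmic derivative of \<open>g ^ m\<close> gives a recurrence for its coefficients \<open>y\<close> with weights
  \<open>(m + 1) * k - n\<close>, which are positive of order \<open>m\<close> for \<open>n\<close> small against \<open>m\<close>. Inductively \<open>y\<close> grows by a
  large factor along every shift by a positive index, so by the covering property each negative term
  is negligible against a positive one.\<close>
lemma coeff_power_nonneg_low:
  assumes cov: "one_sided_pos_covering g"
  shows "\<exists>\<epsilon>>0. \<forall>m n. real n \<le> \<epsilon> * real m \<longrightarrow> coeff (g ^ m) n \<ge> 0"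
proof -
  define S where "S = {k. coeff g k > 0 \<and> k > 0}"
  define N where "N = {k. coeff g k < 0}"
  have finS: "finite S" and finN: "finite N"
    by (auto simp: S_def N_def intro!: finite_subset[of _ "{..degree g}"] le_degree)
  have g0: "coeff g 0 > 0" using cov by (simp add: one_sided_pos_covering_def)
  \<comment> \<open>The inserted 1 is a default for empty \<open>S\<close>.\<close>
  define \<alpha> where "\<alpha> = Min (insert 1 (coeff g ` S))"
  have \<alpha>: "\<alpha> > 0" "\<And>k. k \<in> S \<Longrightarrow> coeff g k \<ge> \<alpha>"
    using finS by (auto simp: \<alpha>_def S_def)
  define W where "W = (\<Sum>q\<in>N. \<bar>coeff g q\<bar> * real q)"
  have W: "W \<ge> 0" unfolding W_def by (intro sum_nonneg) auto
  \<comment> \<open>\<open>\<delta>\<close> is the factor in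
    \<open>y (n - k) \<le> \<delta> * y n\<close> carried by the induction. It is so small that the
    negative terms cost at most half of the positive sum \<open>T\<close>.\<close>
  define \<delta> where "\<delta> = min 1 (\<alpha> / (4 * W + 4))"
  have \<delta>: "\<delta> > 0" "\<delta> \<le> 1" "\<delta> * W \<le> \<alpha> / 4"
  proof -
    show "\<delta> > 0" "\<delta> \<le> 1" using \<alpha> W by (auto simp: \<delta>_def)
    have "\<delta> * W \<le> \<alpha> / (4 * W + 4) * W" using W by (intro mult_right_mono) (auto simp: \<delta>_def)
    also have "\<dots> \<le> \<alpha> / 4" using W \<alpha> by (simp add: field_simps)
    finally show "\<delta> * W \<le> \<alpha> / 4" .
  qed
  \<comment> \<open>The bound 1/2 keeps every weight at least (m + 1) / 2; the other bound lets the
    induction reproduce the factor \<open>\<delta>\<close>.\<close>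
  define \<epsilon> where "\<epsilon> = min (1/2) (\<alpha> * \<delta> / (4 * coeff g 0))"
  have \<epsilon>: "\<epsilon> > 0" "\<epsilon> \<le> 1/2" "4 * coeff g 0 * \<epsilon> \<le> \<alpha> * \<delta>"
  proof -
    show "\<epsilon> > 0" "\<epsilon> \<le> 1/2" using \<alpha> \<delta> g0 by (auto simp: \<epsilon>_def)
    have "\<epsilon> \<le> \<alpha> * \<delta> / (4 * coeff g 0)" by (simp add: \<epsilon>_def)
    thus "4 * coeff g 0 * \<epsilon> \<le> \<alpha> * \<delta>" using g0 by (simp add: field_simps)
  qed
  have "coeff (g ^ m) n \<ge> 0 \<and> (\<forall>k\<in>S. k \<le> n \<longrightarrow> coeff (g ^ m) (n - k) \<le> \<delta> * coeff (g ^ m) n)"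
    if "real n \<le> \<epsilon> * real m" for m n
    using that
  proof (induction n rule: less_induct)
    case (less n)
    define y where "y = coeff (g ^ m)"
    have IH0: "y i \<ge> 0" if "i < n" for i
      using less that by (auto simp: y_def)
    have IH1: "y (i - k) \<le> \<delta> * y i" if "i < n" "k \<in> S" "k \<le> i" for i k
      using less that by (auto simp: y_def)
    have IH2: "y (i - sum_list xs) \<le> y i" if "i < n" "set xs \<subseteq> S" "sum_list xs \<le> i" for i xs
      using that
    proof (induction xs arbitrary: i)
      case (Cons x xs)
      have "y (i - x - sum_list xs) \<le> y (i - x)" using Cons by (intro Cons.IH) auto
      also have "\<dots> \<le> \<delta> * y i" using Cons by (intro IH1) auto
      also have "\<dots> \<le> 1 * y i" using \<delta> Cons IH0 by (intro mult_right_mono) auto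
      finally show ?case by (simp add: diff_diff_add)
    qed auto
    have nm: "2 * real n \<le> real m"
    proof -
      have "real n \<le> \<epsilon> * real m" by fact
      also have "\<dots> \<le> 1/2 * real m" using \<epsilon> by (intro mult_right_mono) auto
      finally show ?thesis by simp
    qed
    show ?case
    proof (cases "n = 0")
      case True
      thus ?thesis using g0 by (auto simp: S_def coeff_0_power)
    next
      case False
      define t where "t k = coeff g k * ((real m + 1) * real k - real n) * y (n - k)" for k
      define P where "P = {k\<in>S. k \<le> n}"
      define Q where "Q = {q\<in>N. q \<le> n}"
      have fin: "finite P" "finite Q" using finS finN by (auto simp: P_def Q_def)
      have wt: "(real m + 1) * real k - real n \<ge> (real m + 1) / 2" if "k > 0" for k
      proof -
        define X where "X = (real m + 1) * real k"
        have "(real m + 1) * 1 \<le> X" unfolding X_def using that by (intro mult_left_mono) auto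
        hence "(real m + 1) / 2 \<le> X - real n" using nm by simp
        thus ?thesis by (simp add: X_def)
      qed
      have tP: "t k \<ge> \<alpha> * ((real m + 1) / 2) * y (n - k) \<and> y (n - k) \<ge> 0" if "k \<in> P" for k
      proof -
        have "k \<in> S" "k > 0" "k \<le> n" using that by (auto simp: P_def S_def)
        moreover from this have "y (n - k) \<ge> 0" using False by (intro IH0) auto
        ultimately show ?thesis unfolding t_def using \<alpha> wt
          by (intro conjI mult_right_mono mult_mono) (auto intro: order.trans less_imp_le)
      qed
      have tP0: "t k \<ge> 0" if "k \<in> P" for k
      proof -
        have "0 \<le> \<alpha> * ((real m + 1) / 2) * y (n - k)"
          using tP[OF that] \<alpha>(1) by (intro mult_nonneg_nonneg) auto
        thus ?thesis using tP[OF that] by linarith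
      qed
      define T where "T = sum t P"
      have T0: "T \<ge> 0" unfolding T_def using tP0 by (intro sum_nonneg) auto
      have Tge: "\<alpha> * ((real m + 1) / 2) * y (n - k) \<le> T" if "k \<in> P" for k
        unfolding T_def using tP[OF that] member_le_sum[of k P t] that tP0 fin by force
      \<comment> \<open>Along q = k + l + rest, the shift by \<open>k\<close> reaches a term of
        \<open>T\<close>, the shift by \<open>l\<close> gains \<open>\<delta>\<close>, and the
        remaining shifts do not increase \<open>y\<close>.\<close>
      have tQ: "- t q \<le> \<bar>coeff g q\<bar> * real q * (2 * \<delta> / \<alpha> * T)" if "q \<in> Q" for q
      proof -
        have q: "coeff g q < 0" "q \<in> neg_support g" "q \<le> n"
          using that by (auto simp: Q_def N_def neg_support_def)
        have q0: "q > 0" using q g0 by (cases q) auto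
        obtain k l xs where klxs: "coeff g k > 0" "k > 0" "coeff g l > 0" "l > 0"
          "\<And>x. x \<in> set xs \<Longrightarrow> coeff g x > 0 \<and> x > 0" "q = k + (l + sum_list xs)"
          by (rule pos_covering_decomposition[OF cov q(2)]) blast
        have "y (n - q) = y (n - k - l - sum_list xs)" by (simp add: klxs(6) add.assoc)
        also have "\<dots> \<le> y (n - k - l)" using klxs q by (intro IH2) (auto simp: S_def)
        also have "\<dots> \<le> \<delta> * y (n - k)" using klxs q by (intro IH1) (auto simp: S_def)
        finally have 1: "y (n - q) \<le> \<delta> * y (n - k)" .
        have "k \<in> P" using klxs q by (auto simp: P_def S_def)
        from Tge[OF this] have 2: "(real m + 1) * y (n - k) \<le> 2 / \<alpha> * T"
          using \<alpha>(1) by (simp add: field_simps)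
        have "- t q = \<bar>coeff g q\<bar> * ((real m + 1) * real q - real n) * y (n - q)"
          using q by (simp add: t_def)
        also have "\<dots> \<le> \<bar>coeff g q\<bar> * ((real m + 1) * real q) * (\<delta> * y (n - k))"
          using q q0 IH0[of "n - q"] 1 wt[OF q0]
          by (intro mult_mono mult_nonneg_nonneg) auto
        also have "\<dots> = \<bar>coeff g q\<bar> * real q * (\<delta> * ((real m + 1) * y (n - k)))"
          by (simp add: mult_ac)
        also have "\<dots> \<le> \<bar>coeff g q\<bar> * real q * (\<delta> * (2 / \<alpha> * T))"
          using \<delta> by (intro mult_left_mono 2) auto
        finally show ?thesis by (simp add: mult_ac)
      qed
      have "- sum t Q \<le> (\<Sum>q\<in>Q. \<bar>coeff g q\<bar> * real q * (2 * \<delta> / \<alpha> * T))"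
        unfolding sum_negf [symmetric] by (intro sum_mono tQ)
      also have "\<dots> = (\<Sum>q\<in>Q. \<bar>coeff g q\<bar> * real q) * (2 * \<delta> / \<alpha> * T)"
        by (rule sum_distrib_right [symmetric])
      also have "\<dots> \<le> W * (2 * \<delta> / \<alpha> * T)"
        unfolding W_def using finN \<alpha> \<delta> T0
        by (intro mult_right_mono sum_mono2) (auto simp: Q_def)
      also have "\<dots> = 2 / \<alpha> * T * (\<delta> * W)" by simp
      also have "\<dots> \<le> 2 / \<alpha> * T * (\<alpha> / 4)" using \<delta> \<alpha> T0 by (intro mult_left_mono) auto
      also have "\<dots> = T / 2" using \<alpha> by simp
      finally have neg: "- sum t Q \<le> T / 2" .
      have "real n * coeff g 0 * y n = (\<Sum>k=1..n. t k)"
        unfolding t_def y_def by (rule coeff_power_recurrence)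
      also have "\<dots> = (\<Sum>k\<in>P \<union> Q. t k)"
        using g0 by (intro sum.mono_neutral_right)
          (auto simp: P_def Q_def S_def N_def t_def not_less Suc_le_eq intro!: gr0I)
      also have "\<dots> = T + sum t Q"
        unfolding T_def using fin by (intro sum.union_disjoint) (auto simp: P_def Q_def S_def N_def)
      finally have rec: "real n * coeff g 0 * y n \<ge> T / 2" using neg by simp
      have y0: "y n \<ge> 0"
      proof (rule ccontr)
        assume "\<not> y n \<ge> 0"
        hence "real n * coeff g 0 * y n < 0" using False g0 by (intro mult_pos_neg) auto
        thus False using rec T0 by simp
      qed
      \<comment> \<open>One positive term is at most \<open>T\<close>, hence at most a multiple of n
        * y n; here n \<le> \<open>\<epsilon> * m\<close> supplies the small factor.\<close>
      have "y (n - k) \<le> \<delta> * y n" if "k \<in> S" "k \<le> n" for k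
      proof -
        have "k \<in> P" using that by (auto simp: P_def)
        have yk: "y (n - k) \<ge> 0" using tP[OF \<open>k \<in> P\<close>] by simp
        have m: "real m > 0" using nm False by linarith
        have "\<alpha> * real m * y (n - k) \<le> \<alpha> * (real m + 1) * y (n - k)"
          using \<alpha> yk by (intro mult_right_mono mult_left_mono) auto
        also have "\<dots> \<le> 2 * T" using Tge[OF \<open>k \<in> P\<close>] by simp
        also have "\<dots> \<le> 4 * (real n * coeff g 0 * y n)" using rec by linarith
        also have "\<dots> \<le> 4 * ((\<epsilon> * real m) * coeff g 0 * y n)"
          using less.prems y0 g0 by (intro mult_left_mono mult_right_mono) auto
        also have "\<dots> = (4 * coeff g 0 * \<epsilon>) * (real m * y n)" by simp
        also have "\<dots> \<le> (\<alpha> * \<delta>) * (real m * y n)" using \<epsilon> y0 by (intro mult_right_mono) auto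
        finally have "(\<alpha> * real m) * y (n - k) \<le> (\<alpha> * real m) * (\<delta> * y n)" by (simp add: mult_ac)
        thus ?thesis using \<alpha> m by simp
      qed
      thus ?thesis using y0 by (auto simp: y_def)
    qed
  qed
  thus ?thesis using \<epsilon>(1) by blast
qed

subsection \<open>The saddle point\<close>

lemma Re_complex_of_real_mult: "Re (of_real a * z) = a * Re z"
  by simp

lemma poly_map_of_real:
  "poly (map_poly of_real p) (z :: complex) = (\<Sum>k\<le>degree p. of_real (coeff p k) * z ^ k)"
  by (simp add: poly_altdef degree_map_poly coeff_map_poly)

lemma poly_map_of_real_power:
  "poly (map_poly of_real (p ^ m)) (z :: complex) = poly (map_poly of_real p) z ^ m"
proof -
  have mult: "map_poly of_real (p * q) = (map_poly of_real p * map_poly of_real q :: complex poly)" for p q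
    by (intro poly_eqI) (simp add: coeff_map_poly coeff_mult)
  have "map_poly of_real (p ^ m) = (map_poly of_real p ^ m :: complex poly)"
    by (induction m) (simp_all add: mult)
  thus ?thesis by simp
qed

text \<open>The weights \<open>tilt g r\<close> sum to \<open>1\<close> but may be negative: they are a signed analogue of the
  exponentially tilted law with generating function \<open>g\<close>. Their Laplace transform, centred at the mean,
  is \<open>tilt_char\<close>.\<close>
definition tilt :: "real poly \<Rightarrow> real \<Rightarrow> nat \<Rightarrow> real" where
  "tilt g r k = coeff g k * r ^ k / poly g r"

text \<open>This is r g'(r) / g(r), so n = m * \<open>tilt_mean g r\<close> is the saddle point
  equation for the coefficient of z^n in g^m.\<close>

definition tilt_mean :: "real poly \<Rightarrow> real \<Rightarrow> real" where
  "tilt_mean g r = (\<Sum>k\<le>degree g. tilt g r k * real k)"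

text \<open>For g(r) > 0 this is the second derivative of log g(e^s) at s = log r. As the weights
  are signed, its positivity is not automatic.\<close>

definition tilt_var :: "real poly \<Rightarrow> real \<Rightarrow> real" where
  "tilt_var g r = (\<Sum>k\<le>degree g. tilt g r k * (real k - tilt_mean g r)\<^sup>2)"

definition tilt_char :: "real poly \<Rightarrow> real \<Rightarrow> complex \<Rightarrow> complex" where
  "tilt_char g r w = (\<Sum>k\<le>degree g. of_real (tilt g r k) * exp (of_real (real k - tilt_mean g r) * w))"

lemma sum_tilt: "poly g r \<noteq> 0 \<Longrightarrow> (\<Sum>k\<le>degree g. tilt g r k) = 1"
  by (simp add: tilt_def flip: sum_divide_distrib poly_altdef)

lemma sum_tilt_centered:
  assumes "poly g r \<noteq> 0"
  shows "(\<Sum>k\<le>degree g. tilt g r k * (real k - tilt_mean g r)) = 0"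
proof -
  have "(\<Sum>k\<le>degree g. tilt g r k * (real k - tilt_mean g r)) =
      tilt_mean g r - (\<Sum>k\<le>degree g. tilt g r k) * tilt_mean g r"
    by (simp add: algebra_simps sum_subtractf sum_distrib_right tilt_mean_def)
  thus ?thesis using sum_tilt[OF assms] by simp
qed

lemma tilt_char_eq:
  "tilt_char g r w = poly (map_poly of_real g) (of_real r * exp w) *
     exp (- of_real (tilt_mean g r) * w) / of_real (poly g r)"
  unfolding tilt_char_def poly_map_of_real tilt_def sum_distrib_right sum_divide_distrib
  by (intro sum.cong refl)
    (simp add: power_mult_distrib exp_of_nat_mult[symmetric] algebra_simps exp_diff exp_minus field_simps)

text \<open>Strong positivity at -r gives g(r) > |g(-r)| \<ge> 0.\<close>

lemma poly_pos_of_strongly_positive: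
  assumes "strongly_positive g" "r > 0"
  shows "poly g r > 0"
proof -
  have "complex_of_real (- r) \<notin> \<real>\<^sub>\<ge>\<^sub>0" using assms by (simp add: nonneg_Reals_of_real_iff del: of_real_minus)
  hence "norm (poly (map_poly of_real g) (complex_of_real (- r))) < poly g (norm (complex_of_real (- r)))"
    using assms unfolding strongly_positive_def by blast
  thus ?thesis using norm_ge_zero[of "poly (map_poly of_real g) (complex_of_real (- r))"] assms(2)
    by (simp del: of_real_minus norm_ge_zero)
qed

lemma exp_imaginary_in_nonneg_Reals:
  assumes "r > 0" "of_real r * exp w \<in> (\<real>\<^sub>\<ge>\<^sub>0 :: complex set)"
  shows "\<exists>n::int. Im w = 2 * pi * of_int n"
proof -
  have "exp w = of_real (norm (exp w))"
    using assms by (auto simp: complex_nonneg_Reals_iff complex_eq_iff cmod_def zero_le_mult_iff)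
  hence "exp w = exp (of_real (Re w))" by (simp add: exp_of_real)
  hence "\<exists>n::int. w = of_real (Re w) + of_int (2 * n) * of_real pi * \<i>" by (simp add: exp_eq)
  then obtain n :: int where "w = of_real (Re w) + of_int (2 * n) * of_real pi * \<i>" by blast
  hence "Im w = Im (of_real (Re w) + of_int (2 * n) * of_real pi * \<i>)" by simp
  thus ?thesis by (auto simp: mult_ac)
qed

lemma norm_tilt_char:
  assumes "poly g r > 0"
  shows "norm (tilt_char g r w) = norm (poly (map_poly of_real g) (of_real r * exp w)) *
     exp (- tilt_mean g r * Re w) / poly g r"
  using assms by (simp add: tilt_char_eq norm_mult norm_divide)

lemma tilt_char_of_real:
  "tilt_char g r (of_real s) = of_real (poly g (r * exp s) * exp (- tilt_mean g r * s) / poly g r)"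
proof -
  have "poly (map_poly of_real g) (of_real x) = (of_real (poly g x) :: complex)" for x
    by (simp add: poly_map_of_real poly_altdef[of g])
  from this[of "r * exp s"] show ?thesis by (simp add: tilt_char_eq exp_of_real[symmetric])
qed

text \<open>Strong positivity in the coordinate z = r e^w: passing from \<open>w\<close> to
  \<open>Re w\<close> replaces z by |z| and preserves the modulus of the centring factor.\<close>

lemma norm_tilt_char_less:
  assumes "strongly_positive g" "r > 0" "\<And>n::int. Im w \<noteq> 2 * pi * of_int n"
  shows "norm (tilt_char g r w) < Re (tilt_char g r (of_real (Re w)))"
proof -
  have "of_real r * exp w \<notin> (\<real>\<^sub>\<ge>\<^sub>0 :: complex set)"
    using exp_imaginary_in_nonneg_Reals assms by blast
  hence "norm (poly (map_poly of_real g) (of_real r * exp w)) < poly g (r * exp (Re w))"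
    using assms(1,2) unfolding strongly_positive_def by (auto simp: norm_mult)
  thus ?thesis using poly_pos_of_strongly_positive[OF assms(1,2)]
    by (simp add: norm_tilt_char tilt_char_of_real divide_strict_right_mono del: of_real_mult of_real_divide)
qed

text \<open>At the exceptional \<open>w\<close> equality holds: although \<open>tilt_char\<close>
  need not be periodic, its modulus has period 2 pi i, and on the real axis it is positive.\<close>

lemma norm_tilt_char_le:
  assumes "strongly_positive g" "r > 0"
  shows "norm (tilt_char g r w) \<le> Re (tilt_char g r (of_real (Re w)))"
proof (cases "\<exists>n::int. Im w = 2 * pi * of_int n")
  case True
  then obtain n :: int where n: "Im w = 2 * pi * of_int n" by blast
  have "exp w = exp (of_real (Re w)) "
    unfolding exp_eq using n by (intro exI[of _ n]) (simp add: complex_eq_iff)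
  hence "norm (tilt_char g r w) = norm (tilt_char g r (of_real (Re w)))"
    using poly_pos_of_strongly_positive[OF assms] by (simp add: norm_tilt_char)
  also have "\<dots> = Re (tilt_char g r (of_real (Re w)))"
    using poly_pos_of_strongly_positive[OF assms]
      poly_pos_of_strongly_positive[OF assms(1), of "r * exp (Re w)"] assms(2)
    by (simp add: tilt_char_of_real norm_mult norm_divide del: of_real_mult of_real_divide)
  finally show ?thesis by simp
next
  case False
  thus ?thesis using norm_tilt_char_less[OF assms] by force
qed

text \<open>Absolute values are taken of the weights too, so that this bounds the cubic Taylor error
  of a signed sum.\<close>

definition tilt_abs_moment :: "real poly \<Rightarrow> real \<Rightarrow> real" where
  "tilt_abs_moment g r = (\<Sum>k\<le>degree g. \<bar>tilt g r k\<bar> * \<bar>real k - tilt_mean g r\<bar> ^ 3)"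

text \<open>The orders 0, 1, 2 contribute total mass 1, centred mean 0 and the variance. The
  remainder of exp is bounded termwise, at purely imaginary arguments.\<close>

lemma tilt_char_Taylor:
  assumes "poly g r \<noteq> 0"
  shows "norm (tilt_char g r (\<i> * of_real \<theta>) - of_real (1 - tilt_var g r * \<theta>\<^sup>2 / 2))
     \<le> tilt_abs_moment g r * \<bar>\<theta>\<bar> ^ 3"
proof -
  define x where "x k = real k - tilt_mean g r" for k
  have "of_real (1 - tilt_var g r * \<theta>\<^sup>2 / 2) = (\<Sum>k\<le>degree g. of_real (tilt g r k)) +
      (\<Sum>k\<le>degree g. of_real (tilt g r k * x k)) * (\<i> * of_real \<theta>) +
      (\<Sum>k\<le>degree g. of_real (tilt g r k * (x k)\<^sup>2)) * (\<i> * of_real \<theta>)\<^sup>2 / 2"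
    using sum_tilt[OF assms] sum_tilt_centered[OF assms]
    by (simp add: tilt_var_def x_def power_mult_distrib flip: of_real_sum del: of_real_mult)
      (simp del: of_real_sum)
  also have "\<dots> = (\<Sum>k\<le>degree g. of_real (tilt g r k) *
      (1 + of_real (x k) * (\<i> * of_real \<theta>) + (of_real (x k) * (\<i> * of_real \<theta>))\<^sup>2 / 2))"
    by (simp add: sum_distrib_left sum_distrib_right sum.distrib algebra_simps power2_eq_square
        sum_divide_distrib sum_negf sum_subtractf)
  finally have "norm (tilt_char g r (\<i> * of_real \<theta>) - of_real (1 - tilt_var g r * \<theta>\<^sup>2 / 2)) =
     norm (\<Sum>k\<le>degree g. of_real (tilt g r k) * (exp (of_real (x k) * (\<i> * of_real \<theta>)) -
      (1 + of_real (x k) * (\<i> * of_real \<theta>) + (of_real (x k) * (\<i> * of_real \<theta>))\<^sup>2 / 2)))"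
    by (simp only: tilt_char_def x_def right_diff_distrib sum_subtractf)
  also have "\<dots> \<le> (\<Sum>k\<le>degree g. \<bar>tilt g r k\<bar> * (\<bar>x k\<bar> ^ 3 * \<bar>\<theta>\<bar> ^ 3))"
  proof (intro sum_norm_le)
    fix k
    let ?z = "of_real (x k) * (\<i> * of_real \<theta>) :: complex"
    have "norm (exp ?z - (1 + ?z + ?z\<^sup>2 / 2)) \<le> norm ?z ^ 3 / 2"
      using Taylor_exp[of ?z 2] by (simp add: numeral_2_eq_2 numeral_3_eq_3)
    also have "\<dots> \<le> \<bar>x k\<bar> ^ 3 * \<bar>\<theta>\<bar> ^ 3"
      by (simp add: norm_mult power_mult_distrib)
    finally show "norm (of_real (tilt g r k) * (exp ?z - (1 + ?z + ?z\<^sup>2 / 2)))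
        \<le> \<bar>tilt g r k\<bar> * (\<bar>x k\<bar> ^ 3 * \<bar>\<theta>\<bar> ^ 3)"
      by (simp only: norm_mult norm_of_real) (intro mult_left_mono, auto)
  qed
  finally show ?thesis by (simp only: tilt_abs_moment_def x_def sum_distrib_right mult.assoc)
qed

lemma norm_tilt_char_imaginary_le:
  assumes "strongly_positive g" "r > 0"
  shows "norm (tilt_char g r (\<i> * of_real \<theta>)) \<le> 1"
  using norm_tilt_char_le[OF assms, of "\<i> * of_real \<theta>"] poly_pos_of_strongly_positive[OF assms]
    tilt_char_of_real[of g r 0] by simp

text \<open>A negative variance would push \<open>tilt_char\<close> above 1 in modulus at small
  imaginary arguments.\<close>

lemma tilt_var_nonneg:
  assumes "strongly_positive g" "r > 0"
  shows "tilt_var g r \<ge> 0"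
proof (rule ccontr)
  assume neg: "\<not> tilt_var g r \<ge> 0"
  define K where "K = tilt_abs_moment g r"
  have K: "K \<ge> 0" unfolding K_def tilt_abs_moment_def by (intro sum_nonneg) auto
  \<comment> \<open>Small enough for the quadratic gain to beat the cubic error; K + 1 avoids
    division by zero.\<close>
  define \<theta> where "\<theta> = - tilt_var g r / (4 * (K + 1))"
  have \<theta>: "\<theta> > 0" unfolding \<theta>_def using neg K by (intro divide_pos_pos) auto
  let ?F = "tilt_char g r (\<i> * of_real \<theta>)"
  have "(1 - tilt_var g r * \<theta>\<^sup>2 / 2) - Re ?F \<le> norm (of_real (1 - tilt_var g r * \<theta>\<^sup>2 / 2) - ?F)"
    using complex_Re_le_cmod[of "of_real (1 - tilt_var g r * \<theta>\<^sup>2 / 2) - ?F"] by simp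
  also have "\<dots> \<le> K * \<theta> ^ 3"
    using tilt_char_Taylor[of g r \<theta>] poly_pos_of_strongly_positive[OF assms] \<theta>
    by (subst norm_minus_commute) (simp add: K_def)
  finally have "(1 - tilt_var g r * \<theta>\<^sup>2 / 2) - Re ?F \<le> K * \<theta> ^ 3" .
  moreover have "Re ?F \<le> 1"
    using norm_tilt_char_imaginary_le[OF assms, of \<theta>] complex_Re_le_cmod[of ?F] by simp
  ultimately have "- tilt_var g r * \<theta>\<^sup>2 / 2 \<le> K * \<theta> ^ 3" by simp
  hence "- tilt_var g r / 2 * \<theta>\<^sup>2 \<le> K * \<theta> * \<theta>\<^sup>2"
    by (simp add: power2_eq_square power3_eq_cube)
  hence "- tilt_var g r / 2 \<le> K * \<theta>" using \<theta> by (subst (asm) mult_le_cancel_right_pos) auto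
  also have "\<dots> \<le> - tilt_var g r / 4" using K neg by (simp add: \<theta>_def field_simps)
  finally show False using neg by simp
qed

lemma higher_deriv_tilt_char:
  "(deriv ^^ n) (tilt_char g r) = (\<lambda>w. \<Sum>k\<le>degree g. of_real (tilt g r k * (real k - tilt_mean g r) ^ n) *
     exp (of_real (real k - tilt_mean g r) * w))"
proof (induction n)
  case (Suc n)
  show ?case unfolding funpow.simps o_def Suc
    by (intro ext DERIV_imp_deriv)
      (auto intro!: derivative_eq_intros sum.cong simp: mult_ac)
qed (simp add: tilt_char_def [abs_def])

lemma holomorphic_tilt_char: "tilt_char g r holomorphic_on S"
  unfolding tilt_char_def [abs_def] by (intro holomorphic_intros)

text \<open>Near its zero of order \<open>n\<close> at the origin, \<open>tilt_char g r w - 1\<close> is \<open>c * w ^ n\<close> to leading order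
  with \<open>c\<close> real. Comparing \<open>w = \<rho> * cis \<psi>\<close> with its real part gives
  \<open>c * (cos (n * \<psi>) - cos \<psi> ^ n) \<le> 0\<close> for all \<open>\<psi>\<close>. If \<open>n \<ge> 3\<close>, the angles \<open>\<pi>/n\<close> and \<open>2\<pi>/n\<close>
  force \<open>c = 0\<close>.\<close>
lemma tilt_var_pos:
  assumes sp: "strongly_positive g" and r: "r > 0"
  shows "tilt_var g r > 0"
proof -
  define F where "F = tilt_char g r"
  have g: "poly g r > 0" using poly_pos_of_strongly_positive[OF assms] .
  have hol: "F holomorphic_on UNIV" by (simp add: F_def holomorphic_tilt_char)
  have F0: "F 0 = 1" using g by (simp add: F_def tilt_char_def sum_tilt flip: of_real_sum)
  define \<mu> where "\<mu> n = (\<Sum>k\<le>degree g. tilt g r k * (real k - tilt_mean g r) ^ n)" for n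
  have der: "(deriv ^^ n) F 0 = of_real (\<mu> n)" for n
    by (simp add: F_def higher_deriv_tilt_char \<mu>_def)
  \<comment> \<open>Otherwise \<open>F\<close> would be constantly 1, against the strict inequality
    at w = i pi.\<close>
  have "\<exists>n>0. \<mu> n \<noteq> 0"
  proof (rule ccontr)
    assume all0: "\<not> ?thesis"
    have "\<mu> n = 0" if "n > 0" for n using all0 that by blast
    hence "F (\<i> * pi) = F 0"
      by (intro holomorphic_fun_eq_const_on_connected[OF hol]) (simp_all add: der connected_UNIV)
    moreover have "norm (F (\<i> * pi)) < Re (F (of_real (Re (\<i> * pi))))"
      unfolding F_def
    proof (rule norm_tilt_char_less[OF assms])
      fix n :: int
      have "1 \<noteq> 2 * (of_int n :: real)"
        by (metis of_int_1 of_int_eq_iff of_int_mult of_int_numeral even_mult_iff odd_one even_numeral)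
      thus "Im (\<i> * pi) \<noteq> 2 * pi * of_int n" by simp
    qed
    ultimately show False by (simp add: F0)
  qed
  define n where "n = (LEAST n. n > 0 \<and> \<mu> n \<noteq> 0)"
  have n: "n > 0" "\<mu> n \<noteq> 0" and least: "\<And>i. 0 < i \<Longrightarrow> i < n \<Longrightarrow> \<mu> i = 0"
    using LeastI_ex[OF \<open>\<exists>n>0. \<mu> n \<noteq> 0\<close>] not_less_Least[of _ "\<lambda>n. n > 0 \<and> \<mu> n \<noteq> 0"]
    unfolding n_def by auto
  obtain h e where h: "0 < e" "h holomorphic_on ball 0 e"
    "\<And>w. w \<in> ball 0 e \<Longrightarrow> F w - F 0 = (w - 0) ^ n * h w" "\<And>w. w \<in> ball 0 e \<Longrightarrow> h w \<noteq> 0"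
    by (rule holomorphic_factor_order_of_zero[OF hol open_UNIV UNIV_I n(1), of 0]) (use n least der in auto)
  define c where "c = Re (h 0)"
  have cont: "isCont h 0"
    using holomorphic_on_imp_continuous_on[OF h(2)] h(1) by (simp add: continuous_on_eq_continuous_at)
  have lim: "((\<lambda>\<rho>. h (of_real \<rho> * u)) \<longlongrightarrow> h 0) (at_right 0)" for u :: complex
  proof -
    have "((\<lambda>\<rho>. of_real \<rho> * u) \<longlongrightarrow> 0) (at_right 0)"
      by (auto intro!: tendsto_eq_intros)
    thus ?thesis using cont isCont_tendsto_compose by blast
  qed
  have small: "eventually (\<lambda>\<rho>. of_real \<rho> * u \<in> ball 0 e \<and> \<rho> > 0) (at_right (0::real))" for u :: complex
  proof -
    have "((\<lambda>\<rho>. of_real \<rho> * u) \<longlongrightarrow> 0) (at_right 0)"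
      by (auto intro!: tendsto_eq_intros)
    hence "eventually (\<lambda>\<rho>. of_real \<rho> * u \<in> ball 0 e) (at_right (0::real))"
      by (rule topological_tendstoD) (use h(1) in auto)
    thus ?thesis using eventually_at_right_less[of 0] by eventually_elim auto
  qed
  have Freal: "Im (F (of_real s)) = 0" for s by (simp add: F_def tilt_char_of_real)
  \<comment> \<open>\<open>F\<close> is real on the real axis, hence so is the limit
    \<open>h 0\<close>.\<close>
  have him: "Im (h 0) = 0"
  proof -
    have "eventually (\<lambda>\<rho>. Im (h (of_real \<rho> * 1)) = 0) (at_right (0::real))"
      using small[of 1]
    proof eventually_elim
      case (elim \<rho>)
      hence "F (of_real \<rho>) - 1 = of_real (\<rho> ^ n) * h (of_real \<rho>)" using h(3) F0 by fastforce
      hence "Im (of_real (\<rho> ^ n) * h (of_real \<rho>)) = Im (F (of_real \<rho>) - 1)" by simp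
      hence "\<rho> ^ n * Im (h (of_real \<rho>)) = 0" using Freal by (simp del: of_real_power)
      thus ?case using elim by simp
    qed
    from tendsto_eventually[OF this] tendsto_Im[OF lim[of 1]] show ?thesis
      by (intro tendsto_unique[of "at_right 0"]) auto
  qed
  have c0: "c \<noteq> 0" using h(4)[of 0] h(1) him by (auto simp: c_def complex_eq_iff)
  \<comment> \<open>|F(w)| \<le> F(Re w) is divided by \<open>\<rho> ^ n\<close>, and
    \<open>\<rho>\<close> tends to 0.\<close>
  have ineq: "c * (cos (real n * \<psi>) - cos \<psi> ^ n) \<le> 0" for \<psi>
  proof -
    have ev: "eventually (\<lambda>\<rho>. Re (cis (real n * \<psi>) * h (of_real \<rho> * cis \<psi>))
       \<le> cos \<psi> ^ n * Re (h (of_real \<rho> * of_real (cos \<psi>)))) (at_right (0::real))"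
      using small[of "cis \<psi>"] small[of "of_real (cos \<psi>)"]
    proof eventually_elim
      case (elim \<rho>)
      define w where "w = of_real \<rho> * cis \<psi>"
      have "Re (F w - 1) \<le> Re (F (of_real (Re w)) - 1)"
        using norm_tilt_char_le[OF assms, of w] complex_Re_le_cmod[of "F w"] by (simp add: F_def)
      also have "of_real (Re w) = of_real \<rho> * complex_of_real (cos \<psi>)" by (simp add: w_def)
      also have "F (of_real \<rho> * complex_of_real (cos \<psi>)) - 1 =
          of_real (\<rho> ^ n) * (of_real (cos \<psi> ^ n) * h (of_real \<rho> * of_real (cos \<psi>)))"
        using h(3)[of "of_real \<rho> * of_real (cos \<psi>)"] elim F0 by (simp add: power_mult_distrib mult_ac)
      also have "F w - 1 = of_real (\<rho> ^ n) * (cis (real n * \<psi>) * h w)"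
        using h(3)[of w] elim F0 by (simp add: w_def power_mult_distrib Complex.DeMoivre mult_ac)
      finally have "\<rho> ^ n * Re (cis (real n * \<psi>) * h w) \<le>
          \<rho> ^ n * (cos \<psi> ^ n * Re (h (of_real \<rho> * of_real (cos \<psi>))))"
        by (simp only: Re_complex_of_real_mult)
      thus ?case using elim by (simp add: w_def)
    qed
    have "Re (cis (real n * \<psi>) * h 0) \<le> cos \<psi> ^ n * Re (h 0)"
      by (rule tendsto_le[OF _ _ _ ev]) (auto intro!: tendsto_intros lim)
    thus ?thesis by (simp add: him c_def algebra_simps)
  qed
  have "\<mu> 1 = 0" using sum_tilt_centered[of g r] g by (simp add: \<mu>_def)
  hence n1: "n \<noteq> 1" using n by auto
  have "n < 3"
  proof (rule ccontr)
    assume "\<not> n < 3"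
    hence n3: "n \<ge> 3" by simp
    have "cos (2 * pi / n) ^ n < 1"
    proof -
      have "cos pi < cos (2 * pi / n)" "cos (2 * pi / n) < cos 0"
        using n3 by (intro cos_monotone_0_pi; simp add: field_simps)+
      hence "\<bar>cos (2 * pi / n)\<bar> < 1" by (simp add: abs_if)
      hence "\<bar>cos (2 * pi / n)\<bar> ^ n < 1" using n by (simp add: power_less_one_iff)
      thus ?thesis using abs_ge_self[of "cos (2 * pi / n) ^ n"] by (simp add: power_abs)
    qed
    moreover have "cos (pi / n) ^ n \<ge> 0"
      using n3 by (intro zero_le_power cos_ge_zero) (auto simp: field_simps intro: order.trans[of _ 0])
    moreover have "c * (1 - cos (2 * pi / n) ^ n) \<le> 0" "c * (- 1 - cos (pi / n) ^ n) \<le> 0"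
      using ineq[of "2 * pi / n"] ineq[of "pi / n"] n by simp_all
    ultimately have "c \<le> 0" "c \<ge> 0"
      by (auto simp: mult_le_0_iff)
    thus False using c0 by simp
  qed
  hence n2: "n = 2" using n n1 by auto
  \<comment> \<open>With n = 2 the second moment is nonzero; only its sign remains to be
    supplied.\<close>
  have "tilt_var g r \<ge> 0" using tilt_var_nonneg[OF assms] .
  moreover have "tilt_var g r \<noteq> 0" using n n2 by (simp add: \<mu>_def tilt_var_def)
  ultimately show ?thesis by simp
qed

subsection \<open>Coefficients of intermediate index\<close>

text \<open>Cauchy's coefficient formula on the circle of radius \<open>r\<close>. Since the
  coefficients are real, the real part is even in the angle and a half circle suffices, whence pi in
  place of 2 pi.\<close>

lemma coeff_has_integral:
  fixes p :: "real poly"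
  shows "((\<lambda>\<theta>. Re (poly (map_poly of_real p) (of_real r * exp (\<i> * of_real \<theta>)) *
      exp (- (\<i> * of_real \<theta> * of_nat n)))) has_integral pi * r ^ n * coeff p n) {0..pi}"
proof -
  have "((\<lambda>\<theta>. cos ((real k - real n) * \<theta>)) has_integral (if k = n then pi else 0)) {0..pi}" for k
  proof (cases "k = n")
    case True
    thus ?thesis using has_integral_const_real[of "1::real" 0 pi] by simp
  next
    case False
    have "((\<lambda>\<theta>. cos ((real k - real n) * \<theta>)) has_integral
        sin ((real k - real n) * pi) / (real k - real n) - sin ((real k - real n) * 0) / (real k - real n)) {0..pi}"
      using False
      by (intro fundamental_theorem_of_calculus)
        (auto intro!: derivative_eq_intros simp: has_real_derivative_iff_has_vector_derivative[symmetric])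
    moreover have "sin ((real k - real n) * pi) = 0"
      by (simp add: left_diff_distrib sin_diff)
    ultimately show ?thesis using False by simp
  qed
  hence "((\<lambda>\<theta>. \<Sum>k\<le>degree p. coeff p k * r ^ k * cos ((real k - real n) * \<theta>)) has_integral
      (\<Sum>k\<le>degree p. coeff p k * r ^ k * (if k = n then pi else 0))) {0..pi}"
    by (intro has_integral_sum has_integral_mult_right) auto
  also have "(\<Sum>k\<le>degree p. coeff p k * r ^ k * (if k = n then pi else 0)) = pi * r ^ n * coeff p n"
    by (simp add: if_distrib[of "\<lambda>x. _ * x"] coeff_eq_0 cong: if_cong)
  also have "(\<lambda>\<theta>. \<Sum>k\<le>degree p. coeff p k * r ^ k * cos ((real k - real n) * \<theta>)) =
     (\<lambda>\<theta>. Re (poly (map_poly of_real p) (of_real r * exp (\<i> * of_real \<theta>)) *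
      exp (- (\<i> * of_real \<theta> * of_nat n))))"
  proof
    fix \<theta> :: real
    have "Re (of_real (coeff p k) * (of_real r * exp (\<i> * of_real \<theta>)) ^ k * exp (- (\<i> * of_real \<theta> * of_nat n)))
       = coeff p k * r ^ k * cos ((real k - real n) * \<theta>)" for k
    proof -
      have "of_real (coeff p k) * (of_real r * exp (\<i> * of_real \<theta>)) ^ k * exp (- (\<i> * of_real \<theta> * of_nat n))
        = of_real (coeff p k * r ^ k) * exp (\<i> * of_real ((real k - real n) * \<theta>))"
        by (simp add: power_mult_distrib exp_of_nat_mult[symmetric] exp_add[symmetric] algebra_simps exp_diff exp_minus field_simps)
      thus ?thesis by (simp only: Re_complex_of_real_mult Re_exp) simp
    qed
    thus "(\<Sum>k\<le>degree p. coeff p k * r ^ k * cos ((real k - real n) * \<theta>)) =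
      Re (poly (map_poly of_real p) (of_real r * exp (\<i> * of_real \<theta>)) * exp (- (\<i> * of_real \<theta> * of_nat n)))"
      by (simp add: poly_map_of_real sum_distrib_right)
  qed
  finally show ?thesis .
qed

text \<open>At the saddle point the factor z^(-n) is absorbed by the centring of the
  \<open>m\<close> factors, which leaves no linear phase.\<close>

lemma coeff_power_has_integral_tilt_char:
  assumes "poly g r > 0" "real n = real m * tilt_mean g r"
  shows "((\<lambda>\<theta>. Re (tilt_char g r (\<i> * of_real \<theta>) ^ m)) has_integral
    pi * r ^ n * coeff (g ^ m) n / poly g r ^ m) {0..pi}"
proof -
  have "Re (tilt_char g r (\<i> * of_real \<theta>) ^ m) =
     Re (poly (map_poly of_real (g ^ m)) (of_real r * exp (\<i> * of_real \<theta>)) *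
      exp (- (\<i> * of_real \<theta> * of_nat n))) / poly g r ^ m" for \<theta>
  proof -
    have "exp (- (\<i> * of_real \<theta> * of_nat n)) = exp (of_nat m * (- of_real (tilt_mean g r) * (\<i> * of_real \<theta>)))"
      using arg_cong[OF assms(2), of complex_of_real] by (simp add: mult_ac)
    also have "\<dots> = exp (- of_real (tilt_mean g r) * (\<i> * of_real \<theta>)) ^ m"
      by (rule exp_of_nat_mult)
    finally have "tilt_char g r (\<i> * of_real \<theta>) ^ m =
       (poly (map_poly of_real (g ^ m)) (of_real r * exp (\<i> * of_real \<theta>)) *
      exp (- (\<i> * of_real \<theta> * of_nat n))) / of_real (poly g r ^ m)"
      by (simp add: tilt_char_eq poly_map_of_real_power power_mult_distrib power_divide)
    thus ?thesis by (simp only: Re_divide_of_real)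
  qed
  thus ?thesis using has_integral_divide[OF coeff_has_integral[of "g ^ m" r n]] by simp
qed

text \<open>The Gaussian is kept only on \<open>{0..\<delta>}\<close>, where it is at least its
  value at \<open>\<delta>\<close>; the cubic error integrates to at most L / (2 a^2), and the far
  range costs at most c * q.\<close>

lemma laplace_lower_bound:
  fixes h :: "real \<Rightarrow> real"
  assumes h: "(h has_integral I) {0..c}"
    and \<delta>: "0 < \<delta>" "\<delta> \<le> \<theta>1" "\<theta>1 \<le> c" and "a > 0" "b \<ge> 0" "L \<ge> 0" "q \<ge> 0"
    and near: "\<And>\<theta>. 0 \<le> \<theta> \<Longrightarrow> \<theta> \<le> \<theta>1 \<Longrightarrow> h \<theta> \<ge> exp (- b * \<theta>\<^sup>2) - L * (\<theta> ^ 3 * exp (- a * \<theta>\<^sup>2))"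
    and far: "\<And>\<theta>. \<theta>1 \<le> \<theta> \<Longrightarrow> \<theta> \<le> c \<Longrightarrow> h \<theta> \<ge> - q"
  shows "I \<ge> \<delta> * exp (- b * \<delta>\<^sup>2) - L / (2 * a\<^sup>2) - c * q"
proof -
  define J where "J = 1 / (2 * a\<^sup>2) - (1 + a * c\<^sup>2) * exp (- a * c\<^sup>2) / (2 * a\<^sup>2)"
  have c: "c > 0" using \<delta> by simp
  have "((\<lambda>\<theta>. \<theta> ^ 3 * exp (- a * \<theta>\<^sup>2)) has_integral
     - (1 + a * c\<^sup>2) * exp (- a * c\<^sup>2) / (2 * a\<^sup>2) - (- (1 + a * 0\<^sup>2) * exp (- a * 0\<^sup>2) / (2 * a\<^sup>2))) {0..c}"
    using \<open>a > 0\<close> c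
    by (intro fundamental_theorem_of_calculus)
      (auto intro!: derivative_eq_intros simp: has_real_derivative_iff_has_vector_derivative[symmetric]
        field_simps power2_eq_square power3_eq_cube)
  hence cubic: "((\<lambda>\<theta>. \<theta> ^ 3 * exp (- a * \<theta>\<^sup>2)) has_integral J) {0..c}"
    by (rule has_integral_eq_rhs) (simp add: J_def diff_divide_distrib left_diff_distrib add_divide_distrib distrib_right)
  have "((\<lambda>\<theta>. exp (- b * \<delta>\<^sup>2)) has_integral \<delta> * exp (- b * \<delta>\<^sup>2)) {0..\<delta>}"
    using has_integral_const_real[of "exp (- b * \<delta>\<^sup>2)" 0 \<delta>] \<delta> by simp
  hence "((\<lambda>\<theta>. if \<theta> \<in> {0..\<delta>} then exp (- b * \<delta>\<^sup>2) else 0) has_integral \<delta> * exp (- b * \<delta>\<^sup>2)) {0..c}"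
    using \<delta> by (subst has_integral_restrict) auto
  from has_integral_diff[OF has_integral_diff[OF this has_integral_mult_right[OF cubic, of L]]
      has_integral_const_real[of q 0 c]]
  \<comment> \<open>A single minorant on the whole interval: both error terms are non-negative and
    may be subtracted everywhere.\<close>
  have low: "((\<lambda>\<theta>. (if \<theta> \<in> {0..\<delta>} then exp (- b * \<delta>\<^sup>2) else 0) - L * (\<theta> ^ 3 * exp (- a * \<theta>\<^sup>2)) - q)
      has_integral \<delta> * exp (- b * \<delta>\<^sup>2) - L * J - c * q) {0..c}"
    using c by simp
  have "\<delta> * exp (- b * \<delta>\<^sup>2) - L * J - c * q \<le> I"
  proof (rule has_integral_le[OF low h])
    fix \<theta> assume \<theta>: "\<theta> \<in> {0..c}"
    have cub: "L * (\<theta> ^ 3 * exp (- a * \<theta>\<^sup>2)) \<ge> 0" using \<theta> \<open>L \<ge> 0\<close> by simp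
    show "(if \<theta> \<in> {0..\<delta>} then exp (- b * \<delta>\<^sup>2) else 0) - L * (\<theta> ^ 3 * exp (- a * \<theta>\<^sup>2)) - q \<le> h \<theta>"
    proof (cases "\<theta> \<le> \<theta>1")
      case True
      have "(if \<theta> \<in> {0..\<delta>} then exp (- b * \<delta>\<^sup>2) else 0) \<le> exp (- b * \<theta>\<^sup>2)"
        using \<theta> \<open>b \<ge> 0\<close> by (auto intro!: mult_left_mono power_mono)
      thus ?thesis using near[of \<theta>] True \<theta> \<open>q \<ge> 0\<close> by simp
    next
      case False
      thus ?thesis using far[of \<theta>] \<theta> \<delta> cub by auto
    qed
  qed
  moreover have "L * J \<le> L * (1 / (2 * a\<^sup>2))"
    using \<open>L \<ge> 0\<close> \<open>a > 0\<close> by (intro mult_left_mono) (auto simp: J_def)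
  ultimately show ?thesis by simp
qed

text \<open>Rescaling to the unit disc. The factor \<open>\<rho> ^ (m - 1)\<close> preserves
  Gaussian decay in the error.\<close>

lemma norm_power_diff_le:
  fixes x y :: complex
  assumes "norm x \<le> \<rho>" "norm y \<le> \<rho>" "\<rho> > 0" "m > 0"
  shows "norm (x ^ m - y ^ m) \<le> real m * norm (x - y) * \<rho> ^ (m - 1)"
proof -
  have "norm ((x / of_real \<rho>) ^ m - (y / of_real \<rho>) ^ m) \<le> real m * norm (x / of_real \<rho> - y / of_real \<rho>)"
    using assms by (intro norm_power_diff) (auto simp: norm_divide)
  also have "x / of_real \<rho> - y / of_real \<rho> = (x - y) / of_real \<rho>" by (simp add: diff_divide_distrib)
  also have "(x / of_real \<rho>) ^ m - (y / of_real \<rho>) ^ m = (x ^ m - y ^ m) / of_real (\<rho> ^ m)"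
    by (simp add: power_divide diff_divide_distrib)
  finally have "norm (x ^ m - y ^ m) / \<rho> ^ m \<le> real m * norm (x - y) / \<rho>"
    using assms by (simp add: norm_divide norm_power del: of_real_power)
  moreover have "\<rho> ^ m = \<rho> * \<rho> ^ (m - 1)" using assms by (cases m) auto
  ultimately show ?thesis using assms by (simp add: field_simps)
qed

text \<open>Both \<open>\<phi>\<close> and exp(-u), with u = B \<theta>^2 / 2, have modulus at most
  exp(-u/2): half of the decay pays for the cubic error. Their difference is of order \<theta>^3,
  and the powers are compared through \<open>norm_power_diff_le\<close>.\<close>

lemma gaussian_approx:
  fixes \<phi> :: complex
  assumes \<phi>: "norm (\<phi> - of_real (1 - B * \<theta>\<^sup>2 / 2)) \<le> K * \<theta> ^ 3"
    and "0 \<le> \<theta>" "\<theta> \<le> 1" "4 * K * \<theta> \<le> B" "B * \<theta>\<^sup>2 \<le> 2" "0 \<le> B" "m > 0"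
  shows "Re (\<phi> ^ m) \<ge> exp (- (real m * B / 2) * \<theta>\<^sup>2) -
    real m * (K + B\<^sup>2) * \<theta> ^ 3 * exp (- (real (m - 1) * B / 4) * \<theta>\<^sup>2)"
proof -
  define u where "u = B * \<theta>\<^sup>2 / 2"
  have u: "0 \<le> u" "u \<le> 1" using assms by (auto simp: u_def)
  define \<rho> where "\<rho> = exp (- u / 2)"
  define y where "y = exp (- u)"
  have K\<theta>: "K * \<theta> ^ 3 \<le> u / 2"
  proof -
    have "4 * K * \<theta> * \<theta>\<^sup>2 \<le> B * \<theta>\<^sup>2" using assms by (intro mult_right_mono) auto
    thus ?thesis by (simp add: u_def power3_eq_cube power2_eq_square)
  qed
  have "norm \<phi> \<le> norm (\<phi> - of_real (1 - u)) + norm (complex_of_real (1 - u))"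
    by (metis add.commute norm_triangle_sub)
  also have "\<dots> \<le> 1 - u / 2" using \<phi> K\<theta> u by (simp add: u_def del: of_real_diff)
  also have "\<dots> \<le> \<rho>" unfolding \<rho>_def using exp_ge_add_one_self[of "- u / 2"] by simp
  finally have 1: "norm \<phi> \<le> \<rho>" .
  have 2: "norm (of_real y :: complex) \<le> \<rho>" using u by (simp add: y_def \<rho>_def)
  have "\<bar>y - (1 - u)\<bar> \<le> exp u * u\<^sup>2"
    using Taylor_exp_field[of "- u" 1] u by (simp add: y_def power2_eq_square)
  also have "\<dots> \<le> 3 * u\<^sup>2"
  proof -
    have "exp u \<le> exp 1" using u by simp
    also have "\<dots> \<le> (3::real)" by (rule exp_le)
    finally show ?thesis by (rule mult_right_mono) simp
  qed
  also have "\<dots> = 3/4 * B\<^sup>2 * (\<theta> ^ 3 * \<theta>)" by (simp add: u_def power2_eq_square power3_eq_cube)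
  also have "\<dots> \<le> 1 * B\<^sup>2 * (\<theta> ^ 3 * 1)" using assms by (intro mult_mono) auto
  finally have y: "\<bar>y - (1 - u)\<bar> \<le> B\<^sup>2 * \<theta> ^ 3" by simp
  have "norm (\<phi> - of_real y) \<le> norm (\<phi> - of_real (1 - u)) + norm (of_real ((1 - u) - y) :: complex)"
    using norm_triangle_ineq[of "\<phi> - of_real (1 - u)" "of_real ((1 - u) - y)"] by simp
  also have "norm (of_real ((1 - u) - y) :: complex) = \<bar>y - (1 - u)\<bar>"
    by (simp only: norm_of_real abs_minus_commute)
  finally have d: "norm (\<phi> - of_real y) \<le> (K + B\<^sup>2) * \<theta> ^ 3"
    using \<phi> y by (simp add: u_def algebra_simps)
  have "norm (\<phi> ^ m - of_real y ^ m) \<le> real m * norm (\<phi> - of_real y) * \<rho> ^ (m - 1)"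
    using 1 2 \<open>m > 0\<close> by (intro norm_power_diff_le) (auto simp: \<rho>_def)
  also have "\<dots> \<le> real m * ((K + B\<^sup>2) * \<theta> ^ 3) * \<rho> ^ (m - 1)"
    using d by (intro mult_right_mono mult_left_mono) (auto simp: \<rho>_def)
  finally have "norm (\<phi> ^ m - of_real y ^ m) \<le> real m * (K + B\<^sup>2) * \<theta> ^ 3 * \<rho> ^ (m - 1)"
    by (simp add: mult_ac)
  moreover have "Re (\<phi> ^ m) \<ge> y ^ m - norm (\<phi> ^ m - of_real y ^ m)"
    using complex_Re_le_cmod[of "of_real y ^ m - \<phi> ^ m"]
    by (simp add: norm_minus_commute flip: of_real_power)
  moreover have "y ^ m = exp (- (real m * B / 2) * \<theta>\<^sup>2)"
    "\<rho> ^ (m - 1) = exp (- (real (m - 1) * B / 4) * \<theta>\<^sup>2)"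
    by (simp_all add: y_def \<rho>_def u_def mult_ac flip: exp_of_nat_mult)
  ultimately show ?thesis by simp
qed

lemma continuous_on_tilt_char:
  assumes "\<And>r. r \<in> S \<Longrightarrow> poly g r \<noteq> 0"
  shows "continuous_on S (tilt_mean g)" "continuous_on S (tilt_var g)" "continuous_on S (tilt_abs_moment g)"
    "continuous_on (S \<times> T) (\<lambda>(r, \<theta>). tilt_char g r (\<i> * of_real \<theta>))"
proof -
  have tilt: "continuous_on S (\<lambda>r. tilt g r k)" for k
    unfolding tilt_def using assms by (intro continuous_intros) auto
  thus mean: "continuous_on S (tilt_mean g)"
    unfolding tilt_mean_def [abs_def] by (intro continuous_intros)
  show "continuous_on S (tilt_var g)" "continuous_on S (tilt_abs_moment g)"
    unfolding tilt_var_def [abs_def] tilt_abs_moment_def [abs_def]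
    by (intro continuous_intros tilt mean)+
  have fst: "continuous_on (S \<times> T) (\<lambda>x. f (fst x))" if "continuous_on S f" for f :: "real \<Rightarrow> real"
    by (rule continuous_on_compose2[OF that]) (auto intro!: continuous_intros)
  show "continuous_on (S \<times> T) (\<lambda>(r, \<theta>). tilt_char g r (\<i> * of_real \<theta>))"
    unfolding tilt_char_def [abs_def] case_prod_unfold
    by (intro continuous_intros fst[OF tilt] fst[OF mean])
qed

text \<open>Relative to the main term of order m^(-1/2), errors of order 1/m and exponentially small
  ones are negligible.\<close>

lemma error_terms_eventually_small:
  fixes \<kappa> C D \<rho> :: real
  assumes "\<kappa> > 0" "0 \<le> \<rho>" "\<rho> < 1"
  shows "eventually (\<lambda>m::nat. C / real m + D * \<rho> ^ m \<le> \<kappa> / sqrt (real m)) sequentially"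
proof -
  have 1: "(\<lambda>m. \<bar>C\<bar> * inverse (sqrt (real m))) \<longlonglongrightarrow> \<bar>C\<bar> * 0"
    by (intro tendsto_intros tendsto_inverse_0_at_top filterlim_compose[OF sqrt_at_top]
        filterlim_real_sequentially)
  have 2: "(\<lambda>m. \<bar>D\<bar> * (real m * \<rho> ^ m)) \<longlonglongrightarrow> \<bar>D\<bar> * 0"
    using assms by (intro tendsto_intros powser_times_n_limit_0) auto
  have "eventually (\<lambda>m. \<bar>C\<bar> * inverse (sqrt (real m)) + \<bar>D\<bar> * (real m * \<rho> ^ m) < \<kappa>) sequentially"
    using order_tendstoD(2)[OF tendsto_add[OF 1 2]] assms by simp
  thus ?thesis using eventually_gt_at_top[of "0::nat"]
  proof eventually_elim
    case (elim m)
    define s where "s = sqrt (real m)"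
    have s: "s > 0" "real m = s * s" "s \<ge> 1" using elim by (auto simp: s_def)
    have "D * \<rho> ^ m * s \<le> \<bar>D\<bar> * \<rho> ^ m * (s * s)"
      using s assms by (intro mult_mono) (auto intro: mult_left_mono)
    moreover have "C / s \<le> \<bar>C\<bar> * inverse s" using s by (simp add: field_simps)
    moreover have "\<bar>C\<bar> * inverse s + \<bar>D\<bar> * (s * s * \<rho> ^ m) < \<kappa>"
      using elim(1) by (simp only: s_def[symmetric]) (simp only: s(2))
    ultimately have "C / s + D * \<rho> ^ m * s < \<kappa>"
      by (simp add: mult_ac)
    hence "(C / s + D * \<rho> ^ m * s) / s \<le> \<kappa> / s" using s by (intro divide_right_mono) auto
    thus ?case unfolding s_def[symmetric] using s by (simp add: add_divide_distrib)
  qed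
qed

text \<open>All constants are extrema over the compact interval of radii, so the threshold for
  \<open>m\<close> depends on neither \<open>r\<close> nor \<open>n\<close>.\<close>

lemma coeff_power_nonneg_tilt:
  assumes sp: "strongly_positive g" and R: "0 < R1"
  shows "eventually (\<lambda>m. \<forall>r n. r \<in> {R1..R2} \<longrightarrow> real n = real m * tilt_mean g r \<longrightarrow> coeff (g ^ m) n \<ge> 0)
    sequentially"
proof (cases "R1 \<le> R2")
  case False
  thus ?thesis by simp
next
  case True
  define S where "S = {R1..R2}"
  have S: "compact S" "S \<noteq> {}" "\<And>r. r \<in> S \<Longrightarrow> r > 0" using R True by (auto simp: S_def)
  have g: "poly g r > 0" if "r \<in> S" for r
    using poly_pos_of_strongly_positive[OF sp S(3)[OF that]] .
  have g': "poly g r \<noteq> 0" if "r \<in> S" for r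
    using g[OF that] by simp
  note cont = continuous_on_tilt_char[where S = S, OF g']
  obtain rb where rb: "rb \<in> S" "\<And>r. r \<in> S \<Longrightarrow> tilt_var g rb \<le> tilt_var g r"
    using continuous_attains_inf[OF S(1,2) cont(2)] by blast
  define b where "b = tilt_var g rb"
  have b: "b > 0" "\<And>r. r \<in> S \<Longrightarrow> b \<le> tilt_var g r"
    using rb tilt_var_pos[OF sp] S(3) by (auto simp: b_def)
  obtain rV where rV: "\<And>r. r \<in> S \<Longrightarrow> tilt_var g r \<le> tilt_var g rV"
    using continuous_attains_sup[OF S(1,2) cont(2)] by blast
  define V where "V = tilt_var g rV"
  have V: "\<And>r. r \<in> S \<Longrightarrow> tilt_var g r \<le> V" using rV by (simp add: V_def)
  have bV: "b \<le> V" using b(2)[OF rb(1)] V[OF rb(1)] by simp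
  obtain rK where rK: "\<And>r. r \<in> S \<Longrightarrow> tilt_abs_moment g r \<le> tilt_abs_moment g rK"
    using continuous_attains_sup[OF S(1,2) cont(3)] by blast
  define K where "K = max 1 (tilt_abs_moment g rK)"
  have K: "K > 0" "\<And>r. r \<in> S \<Longrightarrow> tilt_abs_moment g r \<le> K" using rK by (auto simp: K_def intro: max.coboundedI2)
  \<comment> \<open>The three bounds are those that \<open>gaussian_approx\<close> requires:
    \<theta> \<le> 1, cubic error dominated by the variance, and B \<theta>^2 \<le> 2.\<close>
  define \<theta>1 where "\<theta>1 = min 1 (min (b / (4 * K)) (2 / (V + 1)))"
  have \<theta>1: "0 < \<theta>1" "\<theta>1 \<le> 1" "4 * K * \<theta>1 \<le> b" "V * \<theta>1 \<le> 2"
  proof -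
    show "0 < \<theta>1" "\<theta>1 \<le> 1" using b(1) bV K(1) by (auto simp: \<theta>1_def)
    have "\<theta>1 \<le> b / (4 * K)" by (simp add: \<theta>1_def)
    thus "4 * K * \<theta>1 \<le> b" using K(1) by (simp add: field_simps)
    have "V * \<theta>1 \<le> V * (2 / (V + 1))" using b(1) bV by (intro mult_left_mono) (auto simp: \<theta>1_def)
    also have "\<dots> \<le> 2" using b(1) bV by (simp add: field_simps)
    finally show "V * \<theta>1 \<le> 2" .
  qed
  have \<theta>1pi: "\<theta>1 \<le> pi" using \<theta>1 pi_gt3 by simp
  have "compact (S \<times> {\<theta>1..pi})" "S \<times> {\<theta>1..pi} \<noteq> {}"
    using S(1,2) \<theta>1pi by (auto intro: compact_Times)
  moreover have "continuous_on (S \<times> {\<theta>1..pi}) (\<lambda>x. norm (case x of (r, \<theta>) \<Rightarrow> tilt_char g r (\<i> * of_real \<theta>)))"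
    by (intro continuous_on_norm cont(4))
  ultimately obtain x where x: "x \<in> S \<times> {\<theta>1..pi}"
    "\<And>y. y \<in> S \<times> {\<theta>1..pi} \<Longrightarrow> norm (case y of (r, \<theta>) \<Rightarrow> tilt_char g r (\<i> * of_real \<theta>))
       \<le> norm (case x of (r, \<theta>) \<Rightarrow> tilt_char g r (\<i> * of_real \<theta>))"
    by (metis continuous_attains_sup)
  obtain rx tx where xx: "x = (rx, tx)" by (cases x)
  define \<rho> where "\<rho> = norm (tilt_char g rx (\<i> * of_real tx))"
  have \<rho>: "norm (tilt_char g r (\<i> * of_real \<theta>)) \<le> \<rho>" if "r \<in> S" "\<theta> \<in> {\<theta>1..pi}" for r \<theta>
    using x(2)[of "(r, \<theta>)"] that by (simp add: xx \<rho>_def)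
  \<comment> \<open>The maximum over the compact rectangle is attained at an angle in
    \<open>{\<theta>1..pi}\<close>, which is no multiple of 2 pi, so strictness applies
    there.\<close>
  have "\<rho> < Re (tilt_char g rx (of_real (Re (\<i> * of_real tx))))"
    unfolding \<rho>_def
  proof (rule norm_tilt_char_less[OF sp])
    show "rx > 0" using x S(3) by (auto simp: xx)
    fix n :: int
    have "0 < tx" "tx \<le> pi" using x \<theta>1 by (auto simp: xx)
    moreover have "2 * pi * of_int n \<le> 0" if "n \<le> 0"
      using that by (simp add: mult_nonneg_nonpos)
    moreover have "2 * pi * 1 \<le> 2 * pi * of_int n" if "n \<ge> 1"
      using that by (intro mult_left_mono) auto
    ultimately show "Im (\<i> * of_real tx) \<noteq> 2 * pi * of_int n"
      using pi_gt_zero by (cases "n \<le> 0") auto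
  qed
  hence \<rho>1: "\<rho> < 1" "\<rho> \<ge> 0" using tilt_char_of_real[of g rx 0] g[of rx] x by (auto simp: xx \<rho>_def)
  \<comment> \<open>C / m is the value of L / (2 a^2) for the \<open>a\<close> and \<open>L\<close>
    chosen below.\<close>
  define C where "C = 32 * (K + V\<^sup>2) / b\<^sup>2"
  have ev: "eventually (\<lambda>m::nat. C / real m + pi * \<rho> ^ m \<le> exp (- V / 2) / sqrt (real m)) sequentially"
    using \<rho>1 by (intro error_terms_eventually_small) auto
  \<comment> \<open>Guarantees 1 / sqrt m \<le> \<theta>1 for m \<ge> M.\<close>
  obtain M :: nat where M: "real M \<ge> 1 / \<theta>1\<^sup>2" using real_arch_simple by blast
  show ?thesis
    using ev eventually_ge_at_top[of "max M 2"]
  proof eventually_elim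
    case (elim m)
    hence m: "m \<ge> 2" "real m \<ge> 1 / \<theta>1\<^sup>2" using M by auto
    show ?case unfolding S_def[symmetric]
    proof (intro allI impI)
      fix r n assume r: "r \<in> S" and n: "real n = real m * tilt_mean g r"
      define I where "I = pi * r ^ n * coeff (g ^ m) n / poly g r ^ m"
      have int: "((\<lambda>\<theta>. Re (tilt_char g r (\<i> * of_real \<theta>) ^ m)) has_integral I) {0..pi}"
        unfolding I_def by (rule coeff_power_has_integral_tilt_char[OF g[OF r] n])
      define B where "B = tilt_var g r"
      have B: "b \<le> B" "B \<le> V" using b(2)[OF r] V[OF r] by (auto simp: B_def)
      \<comment> \<open>The natural width of the Gaussian: its exponent at \<open>\<delta>\<close>
        is the constant -V/2.\<close>
      define \<delta> where "\<delta> = 1 / sqrt (real m)"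
      define a where "a = real m * b / 8"
      define L where "L = real m * (K + V\<^sup>2)"
      have "I \<ge> \<delta> * exp (- (real m * V / 2) * \<delta>\<^sup>2) - L / (2 * a\<^sup>2) - pi * \<rho> ^ m"
      proof (rule laplace_lower_bound[OF int, of _ \<theta>1])
        show "0 < \<delta>" "\<theta>1 \<le> pi" "0 < a" "0 \<le> real m * V / 2" "0 \<le> L" "0 \<le> \<rho> ^ m"
          using m b(1) bV K(1) \<theta>1pi \<rho>1 by (auto simp: \<delta>_def a_def L_def)
        have "1 / \<theta>1 \<le> sqrt (real m)" using m(2) by (intro real_le_rsqrt) (simp add: power_divide)
        thus "\<delta> \<le> \<theta>1" using \<theta>1(1) m(1) by (simp add: \<delta>_def field_simps)
      next
        fix \<theta> assume \<theta>: "0 \<le> \<theta>" "\<theta> \<le> \<theta>1"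
        have "Re (tilt_char g r (\<i> * of_real \<theta>) ^ m) \<ge> exp (- (real m * B / 2) * \<theta>\<^sup>2) -
          real m * (K + B\<^sup>2) * \<theta> ^ 3 * exp (- (real (m - 1) * B / 4) * \<theta>\<^sup>2)"
        proof (rule gaussian_approx)
          have "norm (tilt_char g r (\<i> * of_real \<theta>) - of_real (1 - B * \<theta>\<^sup>2 / 2)) \<le> tilt_abs_moment g r * \<theta> ^ 3"
            using tilt_char_Taylor[OF g'[OF r], of \<theta>] \<theta> by (simp only: B_def abs_of_nonneg)
          also have "\<dots> \<le> K * \<theta> ^ 3" using K(2)[OF r] \<theta> by (intro mult_right_mono) auto
          finally show "norm (tilt_char g r (\<i> * of_real \<theta>) - of_real (1 - B * \<theta>\<^sup>2 / 2)) \<le> K * \<theta> ^ 3" .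
          show "0 \<le> \<theta>" "\<theta> \<le> 1" "0 \<le> B" "m > 0" using \<theta> \<theta>1 B b(1) m by auto
          have "4 * K * \<theta> \<le> 4 * K * \<theta>1" using \<theta> K(1) by (intro mult_left_mono) auto
          thus "4 * K * \<theta> \<le> B" using \<theta>1 B by simp
          have "B * \<theta>\<^sup>2 \<le> V * \<theta>1\<^sup>2" using \<theta> B b(1) by (intro mult_mono power_mono) auto
          also have "\<dots> = (V * \<theta>1) * \<theta>1" by (simp add: power2_eq_square)
          also have "\<dots> \<le> 2 * 1" using \<theta>1 by (intro mult_mono) auto
          finally show "B * \<theta>\<^sup>2 \<le> 2" by simp
        qed
        moreover have "exp (- (real m * V / 2) * \<theta>\<^sup>2) \<le> exp (- (real m * B / 2) * \<theta>\<^sup>2)"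
          using B by (auto intro!: mult_right_mono mult_left_mono)
        moreover have "real m * (K + B\<^sup>2) * \<theta> ^ 3 * exp (- (real (m - 1) * B / 4) * \<theta>\<^sup>2)
            \<le> L * \<theta> ^ 3 * exp (- a * \<theta>\<^sup>2)"
        proof (intro mult_mono)
          show "real m * (K + B\<^sup>2) \<le> L" unfolding L_def using B b(1)
            by (intro mult_left_mono add_mono power_mono) auto
          \<comment> \<open>Uses m - 1 \<ge> m / 2, which is why m \<ge> 2 is demanded.\<close>
          have "real m * b / 8 = (real m / 2) * b / 4" by simp
          also have "\<dots> \<le> real (m - 1) * B / 4" using m B b(1)
            by (intro divide_right_mono mult_mono) (auto simp: of_nat_diff)
          finally have "a \<le> real (m - 1) * B / 4" by (simp add: a_def)
          hence "a * \<theta>\<^sup>2 \<le> real (m - 1) * B / 4 * \<theta>\<^sup>2" by (intro mult_right_mono) auto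
          thus "exp (- (real (m - 1) * B / 4) * \<theta>\<^sup>2) \<le> exp (- a * \<theta>\<^sup>2)" by simp
        qed (use \<theta> K(1) in \<open>auto simp: L_def\<close>)
        moreover have "L * (\<theta> ^ 3 * exp (- a * \<theta>\<^sup>2)) = L * \<theta> ^ 3 * exp (- a * \<theta>\<^sup>2)"
          by (rule mult.assoc [symmetric])
        ultimately show "exp (- (real m * V / 2) * \<theta>\<^sup>2) - L * (\<theta> ^ 3 * exp (- a * \<theta>\<^sup>2))
           \<le> Re (tilt_char g r (\<i> * of_real \<theta>) ^ m)"
          by linarith
      next
        fix \<theta> assume "\<theta>1 \<le> \<theta>" "\<theta> \<le> pi"
        hence "norm (tilt_char g r (\<i> * of_real \<theta>)) ^ m \<le> \<rho> ^ m"
          using \<rho>[OF r] by (intro power_mono) auto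
        thus "- (\<rho> ^ m) \<le> Re (tilt_char g r (\<i> * of_real \<theta>) ^ m)"
          using abs_Re_le_cmod[of "tilt_char g r (\<i> * of_real \<theta>) ^ m"] by (simp add: norm_power)
      qed
      moreover have "\<delta> * exp (- (real m * V / 2) * \<delta>\<^sup>2) = exp (- V / 2) / sqrt (real m)"
        using m by (simp add: \<delta>_def power_divide)
      moreover have "L / (2 * a\<^sup>2) = C / real m"
      proof -
        have "L / (2 * a\<^sup>2) = real m * (K + V\<^sup>2) / (real m * (real m * (b\<^sup>2 / 32)))"
          by (simp add: L_def a_def power_mult_distrib power_divide power2_eq_square[of "real m"])
        also have "\<dots> = C / real m" using m(1) by (simp add: C_def mult.commute[of "b\<^sup>2"])
        finally show ?thesis .
      qed
      ultimately have "I \<ge> 0" using elim by simp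
      define A where "A = pi * r ^ n / poly g r ^ m"
      have "A > 0" using S(3)[OF r] g[OF r] by (simp add: A_def)
      moreover have "A * coeff (g ^ m) n \<ge> 0" using \<open>I \<ge> 0\<close> by (simp add: A_def I_def)
      ultimately show "coeff (g ^ m) n \<ge> 0" by (simp add: zero_le_mult_iff)
    qed
  qed
qed

section \<open>Existence of saddle points, and assembly of the three ranges\<close>

lemma tilt_mean_small:
  assumes "coeff g 0 > 0" "\<epsilon> > 0"
  shows "\<exists>r>0. r \<le> 1 \<and> tilt_mean g r \<le> \<epsilon>"
proof -
  have "poly g 0 > 0" using assms by (simp add: poly_0_coeff_0)
  have "isCont (tilt_mean g) 0"
    unfolding tilt_mean_def [abs_def] tilt_def using \<open>poly g 0 > 0\<close> by (intro continuous_intros) auto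
  hence "(tilt_mean g \<longlongrightarrow> tilt_mean g 0) (at_right 0)"
    by (simp add: isCont_def filterlim_at_split)
  moreover have "tilt_mean g 0 = 0"
    unfolding tilt_mean_def tilt_def by (intro sum.neutral) auto
  ultimately have "eventually (\<lambda>r. tilt_mean g r < \<epsilon>) (at_right 0)"
    using assms by (intro order_tendstoD) auto
  moreover have "eventually (\<lambda>r::real. r \<in> {0<..<1}) (at_right 0)"
    by (intro eventually_at_right_real) auto
  ultimately have "eventually (\<lambda>r. r > 0 \<and> r \<le> 1 \<and> tilt_mean g r \<le> \<epsilon>) (at_right 0)"
    by eventually_elim auto
  thus ?thesis using eventually_happens trivial_limit_at_right_real by blast
qed

text \<open>Reversal together with r -> 1/r carries the weight of k to d - k, which turns small
  means into large ones.\<close>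

lemma tilt_mean_reflect_poly:
  assumes "coeff g 0 \<noteq> 0" "r \<noteq> 0" "poly g r \<noteq> 0"
  shows "tilt_mean (reflect_poly g) (inverse r) = real (degree g) - tilt_mean g r"
proof -
  have "tilt (reflect_poly g) (inverse r) k = tilt g r (degree g - k)" if "k \<le> degree g" for k
    using that assms by (simp add: tilt_def coeff_reflect_poly poly_reflect_poly_nz power_diff field_simps)
  hence "tilt_mean (reflect_poly g) (inverse r) = (\<Sum>k\<le>degree g. tilt g r (degree g - k) * real k)"
    using assms by (simp add: tilt_mean_def)
  also have "\<dots> = (\<Sum>k\<le>degree g. tilt g r k * real (degree g - k))"
    by (rule sum.reindex_bij_witness[of _ "\<lambda>k. degree g - k" "\<lambda>k. degree g - k"]) auto
  also have "\<dots> = (\<Sum>k\<le>degree g. tilt g r k) * real (degree g) - tilt_mean g r"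
    by (simp add: of_nat_diff right_diff_distrib sum_subtractf sum_distrib_right tilt_mean_def)
  finally show ?thesis using sum_tilt[OF assms(3)] by simp
qed

lemma tilt_mean_large:
  assumes g: "coeff g 0 > 0" "lead_coeff g > 0" and pos: "\<And>r. r > 0 \<Longrightarrow> poly g r > 0" and "\<epsilon> > 0"
  shows "\<exists>r\<ge>1. tilt_mean g r \<ge> real (degree g) - \<epsilon>"
proof -
  obtain r where r: "r > 0" "r \<le> 1" "tilt_mean (reflect_poly g) r \<le> \<epsilon>"
    using tilt_mean_small[of "reflect_poly g" \<epsilon>] assms by auto
  have "tilt_mean (reflect_poly g) (inverse (inverse r)) = real (degree g) - tilt_mean g (inverse r)"
    using r g pos[of "inverse r"] by (intro tilt_mean_reflect_poly) auto
  moreover have "inverse r \<ge> 1" using r by (simp add: one_le_inverse)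
  ultimately show ?thesis using r by (intro exI[of _ "inverse r"]) auto
qed

text \<open>By the intermediate value theorem, every ratio n/m in the range is the tilted mean at
  some radius in one fixed compact interval.\<close>

lemma coeff_power_nonneg_middle:
  assumes sp: "strongly_positive g" and g: "coeff g 0 > 0" "lead_coeff g > 0" and "\<epsilon> > 0"
  shows "eventually (\<lambda>m. \<forall>n. \<epsilon> * real m \<le> real n \<longrightarrow> real n \<le> (real (degree g) - \<epsilon>) * real m \<longrightarrow>
    coeff (g ^ m) n \<ge> 0) sequentially"
proof -
  have pos: "poly g r > 0" if "r > 0" for r using poly_pos_of_strongly_positive[OF sp that] .
  obtain R1 where R1: "0 < R1" "R1 \<le> 1" "tilt_mean g R1 \<le> \<epsilon>"
    using tilt_mean_small[OF g(1) \<open>\<epsilon> > 0\<close>] by blast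
  obtain R2 where R2: "R2 \<ge> 1" "tilt_mean g R2 \<ge> real (degree g) - \<epsilon>"
    using tilt_mean_large[OF g pos \<open>\<epsilon> > 0\<close>] by blast
  have "poly g r \<noteq> 0" if "r \<in> {R1..R2}" for r
    using pos[of r] R1(1) that by auto
  hence cont: "continuous_on {R1..R2} (tilt_mean g)"
    by (rule continuous_on_tilt_char(1))
  show ?thesis
    using coeff_power_nonneg_tilt[OF sp R1(1), of R2] eventually_gt_at_top[of 0]
  proof eventually_elim
    case (elim m)
    show ?case
    proof (intro allI impI)
      fix n assume n: "\<epsilon> * real m \<le> real n" "real n \<le> (real (degree g) - \<epsilon>) * real m"
      have "\<epsilon> \<le> real n / real m" "real n / real m \<le> real (degree g) - \<epsilon>"
        using n elim(2) by (simp_all add: field_simps)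
      then obtain r where r: "R1 \<le> r" "r \<le> R2" "tilt_mean g r = real n / real m"
        using IVT'[of "tilt_mean g" R1 "real n / real m" R2] R1 R2 cont by force
      thus "coeff (g ^ m) n \<ge> 0" using elim by auto
    qed
  qed
qed

lemma eventually_nonneg_of_strongly_positive:
  assumes sp: "strongly_positive g" and cov: "pos_covering g"
  shows "eventually_nonneg g"
proof -
  have g: "coeff g 0 > 0" "lead_coeff g > 0"
    using cov by (auto simp: pos_covering_def one_sided_pos_covering_def)
  obtain \<epsilon>1 where \<epsilon>1: "\<epsilon>1 > 0" "\<And>m n. real n \<le> \<epsilon>1 * real m \<Longrightarrow> coeff (g ^ m) n \<ge> 0"
    using coeff_power_nonneg_low cov unfolding pos_covering_def by blast
  obtain \<epsilon>2 where \<epsilon>2: "\<epsilon>2 > 0" "\<And>m n. real n \<le> \<epsilon>2 * real m \<Longrightarrow> coeff (reflect_poly g ^ m) n \<ge> 0"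
    using coeff_power_nonneg_low cov unfolding pos_covering_def by blast
  define \<epsilon> where "\<epsilon> = min \<epsilon>1 \<epsilon>2"
  have \<epsilon>: "\<epsilon> > 0" using \<epsilon>1 \<epsilon>2 by (simp add: \<epsilon>_def)
  have "coeff (g ^ m) n \<ge> 0"
    if mid: "\<forall>n. \<epsilon> * real m \<le> real n \<longrightarrow> real n \<le> (real (degree g) - \<epsilon>) * real m \<longrightarrow> coeff (g ^ m) n \<ge> 0"
    for m n
  proof -
    have deg: "degree (g ^ m) = degree g * m" using g by (subst degree_power_eq) auto
    consider "n > degree g * m" | "real n \<le> \<epsilon> * real m" | "\<epsilon> * real m \<le> real n" "real n \<le> (real (degree g) - \<epsilon>) * real m"
      | "n \<le> degree g * m" "real n \<ge> (real (degree g) - \<epsilon>) * real m"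
      by linarith
    thus ?thesis
    proof cases
      case 1
      thus ?thesis by (simp add: coeff_eq_0 deg)
    next
      case 2
      also have "\<epsilon> * real m \<le> \<epsilon>1 * real m" by (intro mult_right_mono) (auto simp: \<epsilon>_def)
      finally show ?thesis by (rule \<epsilon>1(2))
    next
      case 3
      thus ?thesis using mid by blast
    next
      case 4
      \<comment> \<open>The coefficient at \<open>n\<close> is that of the reversed power at d m -
        n, an index in the low range.\<close>
      hence "real (degree g * m - n) \<le> \<epsilon> * real m" by (simp add: of_nat_diff algebra_simps)
      also have "\<epsilon> * real m \<le> \<epsilon>2 * real m" by (intro mult_right_mono) (auto simp: \<epsilon>_def)
      finally have "coeff (reflect_poly g ^ m) (degree g * m - n) \<ge> 0" by (rule \<epsilon>2(2))
      moreover have "\<not> degree g * m < degree g * m - n" by simp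
      ultimately show ?thesis
        using 4(1) by (simp add: reflect_poly_power[symmetric] coeff_reflect_poly deg del: not_less)
    qed
  qed
  thus ?thesis
    using coeff_power_nonneg_middle[OF sp g \<epsilon>] unfolding eventually_nonneg_def eventually_sequentially
    by blast
qed

subsection \<open>Necessity\<close>

lemma coeff_pcompose_monom:
  fixes p :: "real poly"
  assumes "l > 0"
  shows "coeff (pcompose p (monom 1 l)) n = (if l dvd n then coeff p (n div l) else 0)"
proof (induction p arbitrary: n)
  case (pCons a p)
  show ?case
  proof (cases "n < l")
    case True
    thus ?thesis using assms
      by (auto simp: pcompose_pCons coeff_monom_mult coeff_pCons dvd_imp_le split: nat.splits dest: dvd_imp_le)
  next
    case False
    then obtain j where j: "n = l + j" by (metis le_add_diff_inverse not_less)
    thus ?thesis using assms pCons.IH[of j]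
      by (auto simp: pcompose_pCons coeff_monom_mult coeff_pCons split: nat.splits)
  qed
qed simp

lemma pcompose_power: "pcompose (p ^ m) q = pcompose p q ^ m"
  by (induction m) (simp_all add: pcompose_1 pcompose_mult)

text \<open>The coefficients of g^m are merely moved apart and shifted, with zeros in between. For l
  = 0 they would instead be added up.\<close>

lemma eventually_nonneg_monom_mult_pcompose:
  assumes "l > 0"
  shows "eventually_nonneg (monom 1 k * pcompose g (monom 1 l)) \<longleftrightarrow> eventually_nonneg g"
proof -
  have "(\<forall>i. coeff ((monom 1 k * pcompose g (monom 1 l)) ^ m) i \<ge> 0) \<longleftrightarrow> (\<forall>i. coeff (g ^ m) i \<ge> 0)" for m
  proof -
    have eq: "(monom 1 k * pcompose g (monom 1 l)) ^ m = monom 1 (k * m) * pcompose (g ^ m) (monom 1 l)"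
      by (simp add: power_mult_distrib monom_power pcompose_power)
    have c: "coeff (monom 1 (k * m) * pcompose (g ^ m) (monom 1 l)) i =
      (if k * m \<le> i \<and> l dvd (i - k * m) then coeff (g ^ m) ((i - k * m) div l) else 0)" for i
      using assms by (simp add: coeff_monom_mult coeff_pcompose_monom)
    show ?thesis
    proof
      assume *: "\<forall>i. coeff ((monom 1 k * pcompose g (monom 1 l)) ^ m) i \<ge> 0"
      show "\<forall>i. coeff (g ^ m) i \<ge> 0"
      proof
        fix i show "coeff (g ^ m) i \<ge> 0"
          using *[rule_format, of "k * m + l * i"] assms unfolding eq c by simp
      qed
    qed (auto simp: eq c)
  qed
  thus ?thesis by (simp add: eventually_nonneg_def)
qed

lemma eventually_nonneg_lead_coeff_pos:
  assumes "eventually_nonneg g" "g \<noteq> 0"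
  shows "lead_coeff g > 0"
proof -
  obtain m where m: "\<And>k i. k \<ge> m \<Longrightarrow> coeff (g ^ k) i \<ge> 0"
    using assms unfolding eventually_nonneg_def by blast
  \<comment> \<open>An odd exponent beyond the threshold \<open>m\<close>, so that the sign passes
    back to g.\<close>
  have "lead_coeff (g ^ (2 * m + 1)) \<ge> 0" by (intro m) auto
  hence "lead_coeff g ^ (2 * m + 1) \<ge> 0" by (simp only: lead_coeff_power)
  hence "lead_coeff g \<ge> 0" by (subst (asm) zero_le_odd_power) auto
  thus ?thesis using assms(2) by (simp add: less_le)
qed

lemma eventually_nonneg_reflect_poly:
  assumes "eventually_nonneg g"
  shows "eventually_nonneg (reflect_poly g)"
  using assms unfolding eventually_nonneg_def
  by (auto simp: reflect_poly_power[symmetric] coeff_reflect_poly)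

text \<open>Nonzero naturals summing to at most \<open>d\<close> number at most \<open>d\<close>;
  padding with 0 gives exactly \<open>d\<close> summands.\<close>

lemma sum_list_in_sum_set:
  fixes A :: "nat set"
  assumes "set xs \<subseteq> A" "0 \<in> A" "sum_list xs \<le> d"
  shows "sum_list xs \<in> (\<Sum>_<d. A)"
proof -
  define ys where "ys = filter (\<lambda>x. x > 0) xs"
  have sum: "sum_list ys = sum_list xs" unfolding ys_def by (induction xs) auto
  have "length zs \<le> sum_list (zs :: nat list)" if "\<forall>x\<in>set zs. x > 0" for zs
    using that by (induction zs) auto
  from this[of ys] have len: "length ys \<le> d" using sum assms(3) by (auto simp: ys_def)
  define s where "s i = (if i < length ys then ys ! i else 0)" for i
  have "sum s {..<d} = sum s {..<length ys}"
    using len by (intro sum.mono_neutral_right) (auto simp: s_def)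
  also have "\<dots> = sum_list ys"
    by (simp add: s_def sum_list_sum_nth atLeast0LessThan)
  finally have "sum_list xs = sum s {..<d}" using sum by simp
  moreover have "s i \<in> A" for i
    using assms(1,2) nth_mem[of i ys] by (auto simp: s_def ys_def)
  ultimately show ?thesis by (auto simp: set_sum_alt)
qed

text \<open>A minimal index \<open>i\<close> of a negative coefficient outside the monoid generated by the positive support
  can enter \<open>g ^ m\<close> only through a single factor, so it has a negative coefficient there.\<close>
lemma eventually_nonneg_imp_covering:
  assumes ev: "eventually_nonneg g" and g0: "coeff g 0 \<noteq> 0"
  shows "one_sided_pos_covering g"
proof -
  have "g \<noteq> 0" using g0 by auto
  have g0': "coeff g 0 > 0"
    using eventually_nonneg_lead_coeff_pos[OF eventually_nonneg_reflect_poly[OF ev]] g0 \<open>g \<noteq> 0\<close>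
    by (simp add: coeff_reflect_poly)
  \<comment> \<open>The monoid generated by the positive support, with no bound on the number of
    summands; the bound is restored at the end.\<close>
  define M where "M = {sum_list xs |xs. set xs \<subseteq> pos_support g}"
  have M_add: "i + j \<in> M" if ij: "i \<in> M" "j \<in> M" for i j
  proof -
    obtain xs ys where "i = sum_list xs" "j = sum_list ys" "set xs \<subseteq> pos_support g" "set ys \<subseteq> pos_support g"
      using ij unfolding M_def by blast
    thus ?thesis by (auto simp: M_def intro!: exI[of _ "xs @ ys"])
  qed
  have M_pos: "i \<in> M" if "i \<in> pos_support g" for i
    using that by (auto simp: M_def intro!: exI[of _ "[i]"])
  have "neg_support g \<subseteq> M"
  proof (rule ccontr)
    assume "\<not> ?thesis"
    hence ex: "\<exists>i. i \<in> neg_support g - M" by blast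
    define i where "i = (LEAST i. i \<in> neg_support g - M)"
    have i: "i \<in> neg_support g" "i \<notin> M" using LeastI_ex[OF ex] unfolding i_def by blast+
    have i0: "i > 0" using i g0' by (intro gr0I) (auto simp: neg_support_def)
    have supp: "j \<in> M" if "j < i" "coeff g j \<noteq> 0" for j
    proof -
      have "j \<in> neg_support g \<Longrightarrow> j \<in> M" using not_less_Least[OF that(1)[unfolded i_def]] by blast
      thus ?thesis using that(2) M_pos[of j] by (auto simp: neg_support_def pos_support_def neq_iff)
    qed
    have supp': "j \<in> M" if "j < i" "coeff (g ^ m) j \<noteq> 0" for m j
      using that
    proof (induction m arbitrary: j)
      case 0
      hence "j = 0" by (cases j) auto
      thus ?case using M_pos[of 0] g0' by (simp add: pos_support_def)
    next
      case (Suc m)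
      from Suc.prems(2) have "(\<Sum>k\<le>j. coeff g k * coeff (g ^ m) (j - k)) \<noteq> 0"
        by (simp add: coeff_mult)
      then obtain k where "k \<in> {..j}" "coeff g k * coeff (g ^ m) (j - k) \<noteq> 0"
        by (rule sum.not_neutral_contains_not_neutral)
      hence k: "k \<le> j" "coeff g k \<noteq> 0" "coeff (g ^ m) (j - k) \<noteq> 0" by auto
      hence "k + (j - k) \<in> M" using Suc.IH[of "j - k"] Suc.prems(1) supp[of k] by (intro M_add) auto
      thus ?case using k(1) by simp
    qed
    \<comment> \<open>A nonzero term with 0 < k < i would split \<open>i\<close> into two elements
      of \<open>M\<close>, so only k = 0 and k = i contribute.\<close>
    have step: "coeff (g ^ Suc m) i = coeff g 0 * coeff (g ^ m) i + coeff g i * coeff g 0 ^ m" for m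
    proof -
      have "coeff g k * coeff (g ^ m) (i - k) = 0" if "k \<in> {..i} - {0, i}" for k
      proof (rule ccontr)
        assume "\<not> ?thesis"
        hence "k + (i - k) \<in> M" using that supp[of k] supp'[of "i - k" m] by (intro M_add) auto
        thus False using that i by simp
      qed
      hence "coeff (g ^ Suc m) i = (\<Sum>k\<in>{0, i}. coeff g k * coeff (g ^ m) (i - k))"
        unfolding power_Suc coeff_mult by (intro sum.mono_neutral_right) auto
      thus ?thesis using i0 by (simp add: coeff_0_power)
    qed
    have neg: "coeff (g ^ Suc m) i < 0" for m
    proof (induction m)
      case 0
      thus ?case using i by (simp add: neg_support_def)
    next
      case (Suc m)
      have "coeff g 0 * coeff (g ^ Suc m) i < 0" using Suc g0' by (rule mult_pos_neg[rotated])
      moreover have "coeff g i * coeff g 0 ^ Suc m < 0"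
        using i g0' by (intro mult_neg_pos) (auto simp: neg_support_def)
      ultimately show ?case using step[of "Suc m"] by simp
    qed
    obtain m0 where "\<And>m. m \<ge> m0 \<Longrightarrow> coeff (g ^ m) i \<ge> 0"
      using ev unfolding eventually_nonneg_def by blast
    from this[of "Suc m0"] neg[of m0] show False by simp
  qed
  moreover have "i \<in> (\<Sum>_<degree g. pos_support g)" if i: "i \<in> M" "i \<in> neg_support g" for i
  proof -
    obtain xs where xs: "i = sum_list xs" "set xs \<subseteq> pos_support g" using i by (auto simp: M_def)
    have "i \<le> degree g" using that by (intro le_degree) (auto simp: neg_support_def)
    thus ?thesis using xs g0' by (auto simp: pos_support_def intro!: sum_list_in_sum_set)
  qed
  ultimately show ?thesis
    using g0' eventually_nonneg_lead_coeff_pos[OF ev \<open>g \<noteq> 0\<close>]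
    by (auto simp: one_sided_pos_covering_def)
qed

section \<open>Equality in the triangle inequality and strong positivity\<close>

lemma norm_poly_nonneg_coeffs:
  fixes p :: "real poly" and z :: complex
  assumes "\<And>i. coeff p i \<ge> 0"
  shows "norm (poly (map_poly of_real p) z) \<le> poly p (norm z)"
  unfolding poly_map_of_real poly_altdef[of p]
  by (intro sum_norm_le) (simp add: assms norm_mult norm_power)

text \<open>After rotation of the value onto the positive axis by \<open>u\<close>, each term must
  attain its modulus as real part; the positive constant term then forces u = 1.\<close>

lemma norm_poly_nonneg_coeffs_eq:
  fixes p :: "real poly" and z :: complex
  assumes nonneg: "\<And>i. coeff p i \<ge> 0" and p0: "coeff p 0 > 0"
    and eq: "norm (poly (map_poly of_real p) z) = poly p (norm z)" and i: "coeff p i \<noteq> 0"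
  shows "z ^ i = of_real (norm z ^ i)"
proof -
  define P where "P = poly (map_poly of_real p) z"
  define u where "u = (if P = 0 then 1 else cnj (sgn P))"
  have u: "norm u = 1" by (simp add: u_def norm_sgn)
  have "P * u = of_real (norm P)"
    by (auto simp: u_def sgn_div_norm complex_norm_square[symmetric] power2_eq_square field_simps scaleR_conv_of_real)
  hence "Re (P * u) = poly p (norm z)" using eq by (simp add: P_def)
  hence "(\<Sum>k\<le>degree p. coeff p k * norm z ^ k) - (\<Sum>k\<le>degree p. coeff p k * Re (z ^ k * u)) = 0"
    unfolding P_def poly_map_of_real poly_altdef[of p] sum_distrib_right Re_sum
    by (simp add: mult.assoc)
  hence "(\<Sum>k\<le>degree p. coeff p k * (norm z ^ k - Re (z ^ k * u))) = 0"
    by (simp add: right_diff_distrib sum_subtractf)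
  moreover have le: "Re (z ^ k * u) \<le> norm z ^ k" for k
    using complex_Re_le_cmod[of "z ^ k * u"] u by (simp add: norm_mult norm_power)
  ultimately have "\<forall>k\<in>{..degree p}. coeff p k * (norm z ^ k - Re (z ^ k * u)) = 0"
    using nonneg by (subst (asm) sum_nonneg_eq_0_iff) auto
  hence *: "Re (z ^ k * u) = norm z ^ k" if "coeff p k \<noteq> 0" for k
    using that le_degree[OF that] by auto
  have real: "w = of_real (norm w)" if "Re w = norm w" for w :: complex
    using cmod_power2[of w] that by (simp add: complex_eq_iff)
  have "u = 1" using *[of 0] p0 real[of u] u by simp
  thus ?thesis using *[OF i] real[of "z ^ i"] by (simp add: norm_power)
qed

text \<open>The order of \<open>w\<close> divides every element of \<open>K\<close>, hence their
  gcd.\<close>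

lemma eq_1_of_coprime_powers:
  fixes w :: complex
  assumes "\<And>k. k \<in> K \<Longrightarrow> w ^ k = 1" "Gcd K = 1"
  shows "w = 1"
proof -
  have "\<exists>k\<in>K. k > 0" using assms(2) by (metis Gcd_0_iff One_nat_def gr0I singletonI subsetI zero_neq_one)
  hence ex: "\<exists>n>0. w ^ n = 1" using assms(1) by blast
  define n where "n = (LEAST n. n > 0 \<and> w ^ n = 1)"
  have n: "n > 0" "w ^ n = 1" and least: "\<And>m. m < n \<Longrightarrow> m > 0 \<Longrightarrow> w ^ m \<noteq> 1"
    using LeastI_ex[OF ex] not_less_Least[of _ "\<lambda>n. n > 0 \<and> w ^ n = 1"] unfolding n_def by auto
  have "n dvd k" if "k \<in> K" for k
  proof -
    have "w ^ k = (w ^ n) ^ (k div n) * w ^ (k mod n)"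
      by (simp add: power_mult[symmetric] power_add[symmetric])
    hence "w ^ (k mod n) = 1" using assms(1)[OF that] n(2) by simp
    hence "k mod n = 0" using least[of "k mod n"] n(1) by auto
    thus ?thesis by (simp add: mod_eq_0_iff_dvd)
  qed
  hence "n dvd Gcd K" by (intro Gcd_greatest) auto
  thus ?thesis using assms(2) n(2) by simp
qed

text \<open>In the equality case \<open>\<bar>g z\<bar> = g \<bar>z\<bar>\<close> the unimodular number \<open>w = z / \<bar>z\<bar>\<close> leaves the two consecutive powers
  \<open>g ^ m\<close> and \<open>g ^ (m + 1)\<close> invariant under \<open>x \<mapsto> w * x\<close>, hence also their quotient \<open>g\<close>.\<close>
lemma eventually_nonneg_imp_strongly_positive:
  assumes ev: "eventually_nonneg g" and g0: "coeff g 0 \<noteq> 0" and gcd: "Gcd {i. coeff g i \<noteq> 0} = 1"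
  shows "strongly_positive g"
proof -
  have "g \<noteq> 0" using g0 by auto
  have g0': "coeff g 0 > 0"
    using eventually_nonneg_imp_covering[OF ev g0] by (simp add: one_sided_pos_covering_def)
  obtain m0 where m0: "\<And>k i. k \<ge> m0 \<Longrightarrow> coeff (g ^ k) i \<ge> 0"
    using ev unfolding eventually_nonneg_def by blast
  have pow0: "coeff (g ^ k) 0 > 0" for k using g0' by (simp add: coeff_0_power)
  \<comment> \<open>An odd power with non-negative coefficients is bounded below by its positive
    constant term.\<close>
  have pos: "poly g x > 0" if "x \<ge> 0" for x
  proof -
    have "poly g x ^ (2 * m0 + 1) = poly (g ^ (2 * m0 + 1)) x" by (simp only: poly_power)
    also have "\<dots> = (\<Sum>i\<le>degree (g ^ (2 * m0 + 1)). coeff (g ^ (2 * m0 + 1)) i * x ^ i)"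
      by (rule poly_altdef)
    also have "\<dots> \<ge> coeff (g ^ (2 * m0 + 1)) 0 * x ^ 0"
      using that by (intro member_le_sum mult_nonneg_nonneg m0) auto
    finally have "poly g x ^ (2 * m0 + 1) > 0" using pow0[of "2 * m0 + 1"] by simp
    thus ?thesis by (subst (asm) zero_less_power_eq) auto
  qed
  have "norm (poly (map_poly of_real g) z) < poly g (norm z)" if z: "z \<notin> \<real>\<^sub>\<ge>\<^sub>0" for z :: complex
  proof (rule ccontr)
    let ?G = "\<lambda>z. poly (map_poly of_real g) z :: complex"
    assume "\<not> ?thesis"
    hence ge: "poly g (norm z) \<le> norm (?G z)" by simp
    define w where "w = z / of_real (norm z)"
    have z0: "z \<noteq> 0" using z by auto
    have fix_pow: "?G (w * of_real x) ^ k = of_real (poly g x) ^ k" if "k \<ge> m0" for k x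
    proof -
      have "poly g (norm z) ^ k \<le> norm (?G z) ^ k"
        using ge pos[of "norm z"] by (intro power_mono) auto
      hence "norm (poly (map_poly of_real (g ^ k)) z) = poly (g ^ k) (norm z)"
        using norm_poly_nonneg_coeffs[of "g ^ k" z] m0[OF that]
        by (simp add: poly_map_of_real_power norm_power)
      hence zi: "z ^ i = of_real (norm z ^ i)" if "coeff (g ^ k) i \<noteq> 0" for i
        using norm_poly_nonneg_coeffs_eq[of "g ^ k" z i] m0[OF \<open>k \<ge> m0\<close>] pow0 that by blast
      have "w ^ i = 1" if "coeff (g ^ k) i \<noteq> 0" for i
        using zi[OF that] z0 by (simp add: w_def power_divide)
      hence "of_real (coeff (g ^ k) i) * (w * of_real x) ^ i = of_real (coeff (g ^ k) i * x ^ i)" for i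
        by (cases "coeff (g ^ k) i = 0") (auto simp: power_mult_distrib)
      hence "poly (map_poly of_real (g ^ k)) (w * of_real x) = of_real (poly (g ^ k) x)"
        unfolding poly_map_of_real poly_altdef[of "g ^ k"] by (simp only: of_real_sum)
      thus ?thesis by (simp add: poly_map_of_real_power)
    qed
    \<comment> \<open>Quotient of the identities for the exponents m0 and m0 + 1.\<close>
    have fix_g: "?G (w * of_real x) = of_real (poly g x)" if "x > 0" for x
      using fix_pow[of m0 x] fix_pow[of "Suc m0" x] pos[of x] that by auto
    \<comment> \<open>This polynomial is g(w z) - g(z). It vanishes at all positive reals, hence
      identically, so w^i = 1 on the support of g.\<close>
    define q where "q = (\<Sum>i\<le>degree g. monom (of_real (coeff g i) * (w ^ i - 1)) i)"
    have q: "coeff q i = of_real (coeff g i) * (w ^ i - 1)" for i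
      by (simp add: q_def coeff_sum coeff_eq_0)
    have "poly q (of_real x) = ?G (w * of_real x) - of_real (poly g x)" for x
      by (simp add: q_def poly_sum poly_monom poly_map_of_real poly_altdef[of g] sum_subtractf[symmetric]
          power_mult_distrib algebra_simps)
    hence "of_real ` {0<..} \<subseteq> {y. poly q y = 0}" using fix_g by auto
    moreover have "infinite (complex_of_real ` {0<..})"
      by (subst finite_image_iff) (auto simp: inj_on_def infinite_Ioi)
    ultimately have "q = 0" using poly_roots_finite finite_subset by blast
    hence wi: "w ^ i = 1" if "coeff g i \<noteq> 0" for i using q[of i] that by simp
    have "w = 1" by (rule eq_1_of_coprime_powers[OF _ gcd]) (use wi in auto)
    hence "z = of_real (norm z)" using z0 by (simp add: w_def)
    moreover have "complex_of_real (norm z) \<in> \<real>\<^sub>\<ge>\<^sub>0" by (simp add: nonneg_Reals_of_real_iff)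
    ultimately show False using z by simp
  qed
  thus ?thesis using \<open>g \<noteq> 0\<close> by (simp add: strongly_positive_def)
qed

lemma eventually_nonneg_imp_pos_covering:
  assumes "eventually_nonneg g" "coeff g 0 \<noteq> 0"
  shows "pos_covering g"
proof -
  have "coeff (reflect_poly g) 0 \<noteq> 0" using assms(2) by auto
  thus ?thesis unfolding pos_covering_def
    using assms eventually_nonneg_reflect_poly eventually_nonneg_imp_covering by blast
qed

text \<open>\<open>k\<close> is the lowest exponent of f and \<open>l\<close> the gcd of the
  exponents shifted by \<open>k\<close>; l = 0 occurs exactly for monomials.\<close>

lemma poly_decompose_gcd:
  fixes f :: "real poly"
  assumes "f \<noteq> 0"
  obtains k l g where "f = monom 1 k * pcompose g (monom 1 l)" "coeff g 0 \<noteq> 0"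
    "l = 0 \<and> degree g = 0 \<or> l > 0 \<and> Gcd {i. coeff g i \<noteq> 0} = 1"
proof -
  have "coeff f (degree f) \<noteq> 0" using assms by simp
  hence ex: "\<exists>i. coeff f i \<noteq> 0" by blast
  define k where "k = (LEAST i. coeff f i \<noteq> 0)"
  have k: "coeff f k \<noteq> 0" unfolding k_def by (rule LeastI_ex[OF ex])
  have k': "coeff f i = 0" if "i < k" for i
    using not_less_Least[OF that[unfolded k_def]] by simp
  define K where "K = {i. coeff f (i + k) \<noteq> 0}"
  define l where "l = Gcd K"
  have dvd: "l dvd i" if "i \<in> K" for i using that by (simp add: l_def)
  \<comment> \<open>For l = 0 every index i * l + k equals k, so the entries with i > 0 are
    suppressed.\<close>
  define g where "g = (\<Sum>i\<le>degree f. monom (if l = 0 \<and> i > 0 then 0 else coeff f (i * l + k)) i)"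
  have g: "coeff g i = (if l = 0 \<and> i > 0 then 0 else coeff f (i * l + k))" for i
  proof -
    have "coeff f (i * l + k) = 0" if "i > degree f" "l > 0"
    proof (rule coeff_eq_0)
      have "i * 1 \<le> i * l" using that by (intro mult_le_mono2) auto
      thus "degree f < i * l + k" using that by linarith
    qed
    thus ?thesis by (auto simp: g_def coeff_sum)
  qed
  have g0: "coeff g 0 \<noteq> 0" using k by (simp add: g)
  have comp: "coeff (pcompose g (monom 1 l)) i = coeff f (i + k)" for i
  proof (cases "l = 0")
    case True
    hence "K \<subseteq> {0}" by (simp add: l_def)
    hence *: "coeff f (i + k) = 0" if "i > 0" for i using that by (auto simp: K_def)
    have "degree g \<le> 0" using True by (intro degree_le) (auto simp: g)
    hence "degree g = 0" by simp
    then obtain c where "g = [:c:]" by (rule degree_eq_zeroE)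
    thus ?thesis using g[of 0] *[of i] True by (cases i) (auto simp: coeff_pCons)
  next
    case False
    thus ?thesis using dvd[of i] by (auto simp: coeff_pcompose_monom g K_def)
  qed
  have "f = monom 1 k * pcompose g (monom 1 l)"
    by (intro poly_eqI) (simp add: coeff_monom_mult comp k')
  moreover have "l = 0 \<and> degree g = 0 \<or> l > 0 \<and> Gcd {i. coeff g i \<noteq> 0} = 1"
  proof (cases "l = 0")
    case True
    hence "degree g \<le> 0" by (intro degree_le) (auto simp: g)
    thus ?thesis using True by simp
  next
    case False
    have "i \<in> K \<longleftrightarrow> i \<in> (\<lambda>i. l * i) ` {i. coeff g i \<noteq> 0}" for i
    proof (cases "l dvd i")
      case True
      then obtain j where "i = l * j" ..
      thus ?thesis using False by (auto simp: K_def g mult.commute)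
    next
      case False
      thus ?thesis using dvd by auto
    qed
    hence "K = (\<lambda>i. l * i) ` {i. coeff g i \<noteq> 0}" by blast
    hence "l = l * Gcd {i. coeff g i \<noteq> 0}" using Gcd_mult[of l "{i. coeff g i \<noteq> 0}"] by (simp add: l_def)
    thus ?thesis using False by simp
  qed
  ultimately show thesis using g0 that by blast
qed

theorem theorem3:
  fixes f :: "real poly"
  assumes "degree f > 0"
  shows "eventually_nonneg f \<longleftrightarrow>
    (\<exists>k l :: nat. \<exists>g :: real poly.
       f = monom 1 k * pcompose g (monom 1 l) \<and> strongly_positive g \<and> pos_covering g)"
proof
  assume ev: "eventually_nonneg f"
  have "f \<noteq> 0" using assms by auto
  then obtain k l g where f: "f = monom 1 k * pcompose g (monom 1 l)" and g0: "coeff g 0 \<noteq> 0"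
    and l: "l = 0 \<and> degree g = 0 \<or> l > 0 \<and> Gcd {i. coeff g i \<noteq> 0} = 1"
    by (rule poly_decompose_gcd)
  show "\<exists>k l :: nat. \<exists>g :: real poly.
       f = monom 1 k * pcompose g (monom 1 l) \<and> strongly_positive g \<and> pos_covering g"
  proof (cases "l > 0")
    case True
    hence "eventually_nonneg g" using ev f eventually_nonneg_monom_mult_pcompose by simp
    thus ?thesis
      using f l True g0 eventually_nonneg_imp_strongly_positive eventually_nonneg_imp_pos_covering by blast
  next
    case False
    then obtain c where c: "g = [:c:]" using l by (auto elim: degree_eq_zeroE)
    hence f': "f = monom c k" using f by (simp add: smult_monom mult.commute[of _ "[:c:]"])
    have "c > 0" using eventually_nonneg_lead_coeff_pos[OF ev \<open>f \<noteq> 0\<close>] g0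
      by (auto simp: f' c degree_monom_eq)
    \<comment> \<open>The constant c is not strongly positive, since |c| = c at every z. For l = 0
      only the value at 1 matters, and h(1) = c.\<close>
    define h where "h = [:c / 2, c / 2:]"
    have h_nonneg: "coeff h i \<ge> 0" for i
      using \<open>c > 0\<close> by (auto simp: h_def coeff_pCons split: nat.splits)
    have hm: "coeff (h ^ m) i \<ge> 0" for m i
      by (induction m arbitrary: i)
        (auto simp: coeff_mult h_nonneg intro!: sum_nonneg mult_nonneg_nonneg)
    have "eventually_nonneg h" using hm by (auto simp: eventually_nonneg_def)
    moreover have "coeff h 0 \<noteq> 0" using \<open>c > 0\<close> by (simp add: h_def)
    moreover have "Gcd {i. coeff h i \<noteq> 0} = 1"
    proof -
      have "1 \<in> {i. coeff h i \<noteq> 0}" using \<open>c > 0\<close> by (simp add: h_def)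
      hence "Gcd {i. coeff h i \<noteq> 0} dvd 1" by (rule Gcd_dvd)
      thus ?thesis by simp
    qed
    moreover have "f = monom 1 k * pcompose h (monom 1 0)"
      by (simp add: f' h_def pcompose_pCons smult_monom)
    ultimately show ?thesis
      using eventually_nonneg_imp_strongly_positive eventually_nonneg_imp_pos_covering by blast
  qed
next
  assume "\<exists>k l :: nat. \<exists>g :: real poly.
       f = monom 1 k * pcompose g (monom 1 l) \<and> strongly_positive g \<and> pos_covering g"
  then obtain k l g where f: "f = monom 1 k * pcompose g (monom 1 l)"
    and g: "strongly_positive g" "pos_covering g" by blast
  show "eventually_nonneg f"
  proof (cases "l > 0")
    case True
    thus ?thesis
      using eventually_nonneg_of_strongly_positive[OF g] eventually_nonneg_monom_mult_pcompose f by simp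
  next
    case False
    \<comment> \<open>With l = 0, f is a monomial with coefficient g(1) > 0.\<close>
    have "pcompose g (monom 1 0) = [:poly g 1:]"
      by (induction g) (simp_all add: pcompose_pCons monom_0 algebra_simps)
    hence "f = monom (poly g 1) k" using f False by (simp add: smult_monom mult.commute[of _ "[:_:]"])
    moreover have "poly g 1 > 0" using g(1) by (rule poly_pos_of_strongly_positive) simp
    ultimately show ?thesis by (auto simp: eventually_nonneg_def monom_power)
  qed
qed

end
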